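(* Let $X$ and $Y$ be Banach spaces, let $p,q\in[1,+\infty)$, and let $f:\mathbb{R}\times X\to Y$ be a map. For $u:\mathbb{R}\to X$ put $\mathcal{N}_f(u)(t)=f(t,u(t))$, $t\in\mathbb{R}$. The following assertions are equivalent. (i) The operator $\mathcal{N}_f$ maps $S^p_{ap}(\mathbb{R},X)$ into $S^q_{ap}(\mathbb{R},Y)$, and $\mathcal{N}_f:S^p_{ap}(\mathbb{R},X)\to S^q_{ap}(\mathbb{R},Y)$ is continuous. (ii) The operator $G:L^p_1(\mathbb{R},X)\to S^q_{ap}(\mathbb{R},Y)$ given by $G(u)=\mathcal{N}_f(u)$ for $u\in L^p_1(\mathbb{R},X)$ is well-defined (i.e. $\mathcal{N}_f(u)\in S^q_{ap}(\mathbb{R},Y)$ for all $u\in L^p_1(\mathbb{R},X)$) and continuous. (iii) For all $x\in X$, $f(\cdot,x)\in S^q_{ap}(\mathbb{R},Y)$, and the operator $H:L^p_1(\mathbb{R},X)\to BS^q(\mathbb{R},Y)$ given by $H(u)=\mathcal{N}_f(u)$ for $u\in L^p_1(\mathbb{R},X)$ is well-defined (i.e. $\mathcal{N}_f(u)\in BS^q(\mathbb{R},Y)$ for all $u\in L^p_1(\mathbb{R},X)$) and continuous.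
   Context: For a Banach space $E$ and $1\le p<\infty$: $L^p(a,b;E)$ is the space of Bochner $p$-integrable functions on $(a,b)$ (functions equal a.e. are identified), and $L^p_{loc}(\mathbb{R},E)$ is the space of functions $u:\mathbb{R}\to E$ whose restriction to every bounded interval $(a,b)$ is in $L^p(a,b;E)$. The Bochner transform of $u\in L^p_{loc}(\mathbb{R},E)$ is the (continuous) map $u^b:\mathbb{R}\to L^p(0,1;E)$, $u^b(t)(\theta)=u(t+\theta)$, $\theta\in(0,1)$. $BC(\mathbb{R},E)$ is the space of bounded continuous maps $\mathbb{R}\to E$ with the supremum norm. A continuous function $u:\mathbb{R}\to E$ is almost periodic (in the sense of Bohr) if for each $\varepsilon>0$ the set $\{\tau\in\mathbb{R}:\sup_{t\in\mathbb{R}}\|u(t+\tau)-u(t)\|\le\varepsilon\}$ is relatively dense in $\mathbb{R}$ (meets every interval of some fixed length); $AP(\mathbb{R},E)\subset BC(\mathbb{R},E)$ denotes the space of such functions. $BS^p(\mathbb{R},E)=\{u\in L^p_{loc}(\mathbb{R},E): u^b\in BC(\mathbb{R},L^p(0,1;E))\}$, a Banach space with norm $\|u\|_{S^p}=\sup_{t\in\mathbb{R}}\left(\int_0^1\|u(t+\theta)\|^p\,d\theta\right)^{1/p}$. $S^p_{ap}(\mathbb{R},E)=\{u\in L^p_{loc}(\mathbb{R},E): u^b\in AP(\mathbb{R},L^p(0,1;E))\}$ (Stepanov almost periodic functions), a closed subspace of $BS^p(\mathbb{R},E)$ with the same norm. $L^p_1(\mathbb{R},E)=\{u\in L^p_{loc}(\mathbb{R},E):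 u(t+1)=u(t)\text{ for a.e. }t\in\mathbb{R}\}\subset S^p_{ap}(\mathbb{R},E)$, with the norm $\|\cdot\|_{S^p}$, which on this subspace equals $\left(\int_0^1\|u(\theta)\|^p\,d\theta\right)^{1/p}$. *)

theory Defs
  imports "HOL-Analysis.Analysis"
begin

(* Strong (Bochner) measurability. The values need not lie in a separable space, so Borel
   measurability would be too weak. *)
definition strongly_measurable :: "'a measure \<Rightarrow> ('a \<Rightarrow> 'e::real_normed_vector) \<Rightarrow> bool" where
  "strongly_measurable M u \<longleftrightarrow>
     (\<exists>s. (\<forall>i. simple_function M (s i)) \<and> (AE t in M. (\<lambda>i. s i t) \<longlonglongrightarrow> u t))"

(* An element of L^p(a,b;E) is represented by any function on the whole line whose restriction
   to (a,b) is Bochner p-integrable. Identification of a.e. equal functions is not carried out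
   by a quotient: all metric notions below go through the seminorm Lp_norm, which does not see
   the values outside (a,b) or on null sets. *)
definition Lp :: "real \<Rightarrow> real \<Rightarrow> real \<Rightarrow> (real \<Rightarrow> 'e::real_normed_vector) set" where
  "Lp p a b = {u. strongly_measurable (lebesgue_on {a<..<b}) u \<and>
                  integrable (lebesgue_on {a<..<b}) (\<lambda>t. norm (u t) powr p)}"

definition Lp_norm :: "real \<Rightarrow> real \<Rightarrow> real \<Rightarrow> (real \<Rightarrow> 'e::real_normed_vector) \<Rightarrow> real" where
  "Lp_norm p a b u =
     (integral\<^sup>L (lebesgue_on {a<..<b}) (\<lambda>t. norm (u t) powr p)) powr (1 / p)"

definition Lp_loc :: "real \<Rightarrow> (real \<Rightarrow> 'e::real_normed_vector) set" where
  "Lp_loc p = {u. \<forall>a b. u \<in> Lp p a b}"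

definition bochner_transform :: "(real \<Rightarrow> 'e) \<Rightarrow> real \<Rightarrow> (real \<Rightarrow> 'e)" where
  "bochner_transform u t = (\<lambda>\<theta>. u (t + \<theta>))"

(* Continuity of a map on A for the distances N1 (y - x) and N2 (F y - F x) given by (semi)norms.
   For function spaces, subtraction is pointwise. *)
definition norm_continuous_on ::
  "('v::minus \<Rightarrow> real) \<Rightarrow> ('w::minus \<Rightarrow> real) \<Rightarrow> 'v set \<Rightarrow> ('v \<Rightarrow> 'w) \<Rightarrow> bool" where
  "norm_continuous_on N1 N2 A F \<longleftrightarrow>
     (\<forall>x\<in>A. \<forall>\<epsilon>>0. \<exists>\<delta>>0. \<forall>y\<in>A. N1 (y - x) < \<delta> \<longrightarrow> N2 (F y - F x) < \<epsilon>)"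

(* BC and AP with values in a space V carrying the (semi)norm N. *)
definition BC :: "'v::minus set \<Rightarrow> ('v \<Rightarrow> real) \<Rightarrow> (real \<Rightarrow> 'v) set" where
  "BC V N = {F. range F \<subseteq> V \<and> norm_continuous_on norm N UNIV F \<and> (\<exists>B. \<forall>t. N (F t) \<le> B)}"

definition relatively_dense :: "real set \<Rightarrow> bool" where
  "relatively_dense T \<longleftrightarrow> (\<exists>l>0. \<forall>a. {a..a + l} \<inter> T \<noteq> {})"

definition AP :: "'v::minus set \<Rightarrow> ('v \<Rightarrow> real) \<Rightarrow> (real \<Rightarrow> 'v) set" where
  "AP V N = {F. range F \<subseteq> V \<and> norm_continuous_on norm N UNIV F \<and>
     (\<forall>\<epsilon>>0. relatively_dense {\<tau>. (SUP t. ereal (N (F (t + \<tau>) - F t))) \<le> ereal \<epsilon>})}"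

definition BSp :: "real \<Rightarrow> (real \<Rightarrow> 'e::real_normed_vector) set" where
  "BSp p = {u \<in> Lp_loc p. bochner_transform u \<in> BC (Lp p 0 1) (Lp_norm p 0 1)}"

definition Sp_ap :: "real \<Rightarrow> (real \<Rightarrow> 'e::real_normed_vector) set" where
  "Sp_ap p = {u \<in> Lp_loc p. bochner_transform u \<in> AP (Lp p 0 1) (Lp_norm p 0 1)}"

(* A real supremum, meaningful only for u in BSp p (which contains Sp_ap p and Lp_per p). *)
definition Sp_norm :: "real \<Rightarrow> (real \<Rightarrow> 'e::real_normed_vector) \<Rightarrow> real" where
  "Sp_norm p u = (SUP t. Lp_norm p 0 1 (bochner_transform u t))"

(* The space written L^p_1: locally L^p functions of period 1. *)
definition Lp_per :: "real \<Rightarrow> (real \<Rightarrow> 'e::real_normed_vector) set" where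
  "Lp_per p = {u \<in> Lp_loc p. AE t in lebesgue. u (t + 1) = u t}"

definition nemytskii :: "(real \<times> 'x \<Rightarrow> 'y) \<Rightarrow> (real \<Rightarrow> 'x) \<Rightarrow> (real \<Rightarrow> 'y)" where
  "nemytskii f u = (\<lambda>t. f (t, u t))"

end

theory Submission
  imports Defs
begin

text \<open>
  The only substantial implication is from (iii) to (i). On a window $(t, t + 1)$ a Stepanov almost
  periodic function $u$ coincides with a 1-periodic function. As $t$ varies, these periodizations of
  $u$ and their translates form a totally bounded set in $L^p(0,1;X)$, which is complete, so the
  continuity of $H$ is uniform near this set. This makes the continuity of $N_f$ uniform over all
  windows and all translates of $u$. For almost periodicity, $u$ is replaced on every window by a
  function with values in a finite set $F$ that does not depend on the window; then
  $f(s + \<tau>, w(s)) - f(s, w(s))$ is controlled by the finitely many almost periodic functions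
  $f(\<cdot>, x)$ with $x \<in> F$, which have common almost periods with $u$.
\<close>

subsection \<open>Strong measurability on Lebesgue sets\<close>

text \<open>Assertion (iii) gives continuity of \<open>H\<close> at one periodic function at a time,
  with a \<open>\<delta>\<close> that depends on this function, whereas (i) concerns uncountably
  many windows at once; total boundedness closes this gap. A second obstacle is that
  \<open>f\<close> depends on time and is not periodic in it, so a window of \<open>u\<close> cannot
  simply be moved to (0,1) and evaluated there. The content of a window and the place where
  \<open>f\<close> acts on it are therefore independent parameters, \<open>t\<close> and
  \<open>c\<close>, of the periodizations, and the supremum over all windows in the norm of
  \<open>BSp q\<close> gives the estimate at whichever place is needed. Finite-valued functions
  enter because common almost periods are obtained by a pigeonhole argument for finitely many
  functions, while \<open>u\<close> may take infinitely many values. As functions equal a.e. are not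
  identified, all distances are seminorms; the compactness argument is therefore stated for abstract
  distances and uses total boundedness and rapidly convergent sequences only.\<close>

text \<open>Extension by zero makes the approximating simple functions global, so that they can be
  translated, glued and subtracted on the whole space; only the convergence stays restricted to
  \<open>S\<close>.\<close>

lemma strongly_measurable_lebesgue_on_iff:
  fixes u :: "'a::euclidean_space \<Rightarrow> 'e::real_normed_vector"
  assumes "S \<in> sets lebesgue"
  shows "strongly_measurable (lebesgue_on S) u \<longleftrightarrow>
    (\<exists>s. (\<forall>i. simple_function lebesgue (s i)) \<and> (AE t in lebesgue. t \<in> S \<longrightarrow> (\<lambda>i. s i t) \<longlonglongrightarrow> u t))"
    (is "?L \<longleftrightarrow> ?R")
proof
  assume ?L
  then obtain s where s: "\<And>i. simple_function (lebesgue_on S) (s i)"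
    "AE t in lebesgue_on S. (\<lambda>i. s i t) \<longlonglongrightarrow> u t"
    unfolding strongly_measurable_def by auto
  have "simple_function lebesgue (\<lambda>t. indicator S t *\<^sub>R s i t)" for i
    using s(1)[of i] assms by (subst (asm) simple_function_restrict_space) auto
  moreover have "AE t in lebesgue. t \<in> S \<longrightarrow> (\<lambda>i. indicator S t *\<^sub>R s i t) \<longlonglongrightarrow> u t"
    using s(2) assms by (subst (asm) AE_restrict_space_iff) (auto elim!: AE_mp)
  ultimately show ?R by (intro exI[of _ "\<lambda>i t. indicator S t *\<^sub>R s i t"]) auto
next
  assume ?R
  then obtain s where s: "\<And>i. simple_function lebesgue (s i)"
    "AE t in lebesgue. t \<in> S \<longrightarrow> (\<lambda>i. s i t) \<longlonglongrightarrow> u t" by auto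
  have "simple_function (lebesgue_on S) (s i)" for i
    using s(1)[of i] assms
    by (subst simple_function_restrict_space) (auto intro!: simple_function_compose2[where h="(*\<^sub>R)"])
  then show ?L
    unfolding strongly_measurable_def using s(2) assms
    by (intro exI[of _ s]) (auto simp: AE_restrict_space_iff)
qed

lemma strongly_measurableI:
  fixes u :: "'a::euclidean_space \<Rightarrow> 'e::real_normed_vector"
  assumes "S \<in> sets lebesgue" "\<And>i. simple_function lebesgue (s i)"
    "AE t in lebesgue. t \<in> S \<longrightarrow> (\<lambda>i. s i t) \<longlonglongrightarrow> u t"
  shows "strongly_measurable (lebesgue_on S) u"
  using assms by (auto simp: strongly_measurable_lebesgue_on_iff)

lemma strongly_measurableE:
  fixes u :: "'a::euclidean_space \<Rightarrow> 'e::real_normed_vector"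
  assumes "strongly_measurable (lebesgue_on S) u" "S \<in> sets lebesgue"
  obtains s where "\<And>i. simple_function lebesgue (s i)"
    "AE t in lebesgue. t \<in> S \<longrightarrow> (\<lambda>i. s i t) \<longlonglongrightarrow> u t"
  using assms by (auto simp: strongly_measurable_lebesgue_on_iff)

lemma strongly_measurable_simple:
  assumes "S \<in> sets lebesgue" "simple_function lebesgue u"
  shows "strongly_measurable (lebesgue_on S) u"
  using assms by (intro strongly_measurableI[where s = "\<lambda>_. u"]) auto

lemma strongly_measurable_diff:
  fixes u v :: "'a::euclidean_space \<Rightarrow> 'e::real_normed_vector"
  assumes "S \<in> sets lebesgue" "strongly_measurable (lebesgue_on S) u" "strongly_measurable (lebesgue_on S) v"
  shows "strongly_measurable (lebesgue_on S) (u - v)"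
proof -
  obtain s where s: "\<And>i. simple_function lebesgue (s i)"
    "AE t in lebesgue. t \<in> S \<longrightarrow> (\<lambda>i. s i t) \<longlonglongrightarrow> u t"
    using strongly_measurableE assms by blast
  obtain r where r: "\<And>i. simple_function lebesgue (r i)"
    "AE t in lebesgue. t \<in> S \<longrightarrow> (\<lambda>i. r i t) \<longlonglongrightarrow> v t"
    using strongly_measurableE assms by blast
  show ?thesis
  proof (rule strongly_measurableI[OF assms(1)])
    show "simple_function lebesgue (\<lambda>t. s i t - r i t)" for i
      using s r by auto
    show "AE t in lebesgue. t \<in> S \<longrightarrow> (\<lambda>i. s i t - r i t) \<longlonglongrightarrow> (u - v) t"
      using s(2) r(2) by eventually_elim (auto intro!: tendsto_diff)
  qed
qed

lemma strongly_measurable_norm: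
  fixes u :: "'a::euclidean_space \<Rightarrow> 'e::real_normed_vector"
  assumes "S \<in> sets lebesgue" "strongly_measurable (lebesgue_on S) u"
  shows "strongly_measurable (lebesgue_on S) (\<lambda>x. norm (u x))"
proof -
  obtain s where s: "\<And>i. simple_function lebesgue (s i)"
    "AE t in lebesgue. t \<in> S \<longrightarrow> (\<lambda>i. s i t) \<longlonglongrightarrow> u t"
    using strongly_measurableE assms by blast
  show ?thesis
  proof (rule strongly_measurableI[OF assms(1)])
    show "simple_function lebesgue (\<lambda>t. norm (s i t))" for i
      using s(1)[of i] by (rule simple_function_compose1)
    show "AE t in lebesgue. t \<in> S \<longrightarrow> (\<lambda>i. norm (s i t)) \<longlonglongrightarrow> norm (u t)"
      using s(2) by eventually_elim (auto intro!: tendsto_norm)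
  qed
qed

lemma strongly_measurable_AE_cong:
  fixes u :: "'a::euclidean_space \<Rightarrow> 'e::real_normed_vector"
  assumes "S \<in> sets lebesgue" "strongly_measurable (lebesgue_on S) u"
    "AE t in lebesgue. t \<in> S \<longrightarrow> u t = v t"
  shows "strongly_measurable (lebesgue_on S) v"
proof -
  obtain s where s: "\<And>i. simple_function lebesgue (s i)"
    "AE t in lebesgue. t \<in> S \<longrightarrow> (\<lambda>i. s i t) \<longlonglongrightarrow> u t"
    using strongly_measurableE assms by blast
  show ?thesis
    proof (rule strongly_measurableI[OF assms(1) s(1)])
    show "AE t in lebesgue. t \<in> S \<longrightarrow> (\<lambda>i. s i t) \<longlonglongrightarrow> v t"
      using s(2) assms(3) by eventually_elim auto
  qed
qed

lemma strongly_measurable_AE_subset: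
  fixes u :: "'a::euclidean_space \<Rightarrow> 'e::real_normed_vector"
  assumes "S \<in> sets lebesgue" "strongly_measurable (lebesgue_on S) u" "T \<in> sets lebesgue"
    "AE t in lebesgue. t \<in> T \<longrightarrow> t \<in> S"
  shows "strongly_measurable (lebesgue_on T) u"
proof -
  obtain s where s: "\<And>i. simple_function lebesgue (s i)"
    "AE t in lebesgue. t \<in> S \<longrightarrow> (\<lambda>i. s i t) \<longlonglongrightarrow> u t"
    using strongly_measurableE assms by blast
  show ?thesis
    proof (rule strongly_measurableI[OF assms(3) s(1)])
    show "AE t in lebesgue. t \<in> T \<longrightarrow> (\<lambda>i. s i t) \<longlonglongrightarrow> u t"
      using s(2) assms(4) by eventually_elim auto
  qed
qed

lemma strongly_measurable_Un:
  fixes u :: "'a::euclidean_space \<Rightarrow> 'e::real_normed_vector"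
  assumes "S \<in> sets lebesgue" "strongly_measurable (lebesgue_on S) u"
    "T \<in> sets lebesgue" "strongly_measurable (lebesgue_on T) u"
  shows "strongly_measurable (lebesgue_on (S \<union> T)) u"
proof -
  obtain s where s: "\<And>i. simple_function lebesgue (s i)"
    "AE t in lebesgue. t \<in> S \<longrightarrow> (\<lambda>i. s i t) \<longlonglongrightarrow> u t"
    using strongly_measurableE assms by blast
  obtain r where r: "\<And>i. simple_function lebesgue (r i)"
    "AE t in lebesgue. t \<in> T \<longrightarrow> (\<lambda>i. r i t) \<longlonglongrightarrow> u t"
    using strongly_measurableE assms by blast
  show ?thesis
  proof (rule strongly_measurableI)
    show "simple_function lebesgue (\<lambda>t. if t \<in> S then s i t else r i t)" for i
      using s r assms by (intro simple_function_If_set) auto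
    show "AE t in lebesgue. t \<in> S \<union> T \<longrightarrow> (\<lambda>i. if t \<in> S then s i t else r i t) \<longlonglongrightarrow> u t"
      using s(2) r(2)
    proof eventually_elim
      case (elim t)
      then show ?case by (cases "t \<in> S") auto
    qed
  qed (use assms in auto)
qed

section \<open>Translation invariance and measurability of a.e. limits\<close>

lemma measurable_lebesgue_translation: "(\<lambda>x. x + c :: real) \<in> lebesgue \<rightarrow>\<^sub>M lebesgue"
  using lebesgue_affine_measurable[where c = "\<lambda>_::real. 1" and t = c] by (simp add: add.commute)

lemma distr_lebesgue_translation: "distr lebesgue lebesgue (\<lambda>x. x + c :: real) = lebesgue"
  using lebesgue_real_affine[of 1 c] by (simp add: density_1 add.commute)

lemma AE_lebesgue_translation:
  assumes "AE x in lebesgue. P x"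
  shows "AE x in lebesgue. P (x + c :: real)"
proof -
  have "AE x in distr lebesgue lebesgue (\<lambda>x. x + c). P x"
    using assms by (simp only: distr_lebesgue_translation)
  then show ?thesis
    by (rule AE_distrD[OF measurable_lebesgue_translation])
qed

lemma nn_integral_lebesgue_translation:
  assumes "f \<in> borel_measurable lebesgue"
  shows "(\<integral>\<^sup>+x. f (x + c :: real) \<partial>lebesgue) = (\<integral>\<^sup>+x. f x \<partial>lebesgue)"
  using nn_integral_real_affine_lebesgue[OF assms, of 1 c] by (simp add: add.commute)

lemma simple_function_lebesgue_translation:
  assumes "simple_function lebesgue s"
  shows "simple_function lebesgue (\<lambda>x. s (x + c :: real))"
  using simple_function_comp[OF measurable_lebesgue_translation[of c] assms] by (simp add: comp_def)

lemma strongly_measurable_translation: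
  assumes "strongly_measurable (lebesgue_on {a<..<b}) u"
  shows "strongly_measurable (lebesgue_on {a - c<..<b - c}) (\<lambda>x. u (x + c :: real))"
proof -
  obtain s where s: "\<And>i. simple_function lebesgue (s i)"
    "AE t in lebesgue. t \<in> {a<..<b} \<longrightarrow> (\<lambda>i. s i t) \<longlonglongrightarrow> u t"
    using strongly_measurableE[OF assms] by auto
  show ?thesis
  proof (rule strongly_measurableI[OF _ simple_function_lebesgue_translation[OF s(1), where c = c]])
    show "AE t in lebesgue. t \<in> {a - c<..<b - c} \<longrightarrow> (\<lambda>i. s i (t + c)) \<longlonglongrightarrow> u (t + c)"
      using AE_lebesgue_translation[OF s(2), of c] by eventually_elim auto
  qed auto
qed

text \<open>The pointwise \<open>lim\<close> is measurable even if the sequence diverges on a null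
  set, and completeness of Lebesgue measure passes measurability on to every function that equals it
  a.e.\<close>

lemma borel_measurable_AE_LIMSEQ_lebesgue:
  fixes g :: "'a::euclidean_space \<Rightarrow> real"
  assumes "\<And>i. G i \<in> borel_measurable lebesgue" "AE x in lebesgue. (\<lambda>i. G i x) \<longlonglongrightarrow> g x"
  shows "g \<in> borel_measurable lebesgue"
proof (rule borel_measurable_AE)
  show "(\<lambda>x. lim (\<lambda>i. G i x)) \<in> borel_measurable lebesgue"
    using assms(1) by (rule borel_measurable_lim_metric)
  show "AE x in lebesgue. lim (\<lambda>i. G i x) = g x"
    using assms(2) by eventually_elim (rule limI)
qed

lemma strongly_measurable_imp_borel_measurable:
  fixes u :: "'a::euclidean_space \<Rightarrow> real"
  assumes "S \<in> sets lebesgue" "strongly_measurable (lebesgue_on S) u"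
  shows "(\<lambda>x. indicator S x * u x) \<in> borel_measurable lebesgue"
proof -
  obtain s where s: "\<And>i. simple_function lebesgue (s i)"
    "AE t in lebesgue. t \<in> S \<longrightarrow> (\<lambda>i. s i t) \<longlonglongrightarrow> u t"
    using strongly_measurableE assms by blast
  show ?thesis
  proof (rule borel_measurable_AE_LIMSEQ_lebesgue)
    show "(\<lambda>x. indicator S x * s i x) \<in> borel_measurable lebesgue" for i
      using assms(1) borel_measurable_simple_function[OF s(1)[of i]] by measurable
    show "AE x in lebesgue. (\<lambda>i. indicator S x * s i x) \<longlonglongrightarrow> indicator S x * u x"
      using s(2) by eventually_elim (auto simp: indicator_def)
  qed
qed

subsection \<open>The seminormed spaces of p-integrable functions\<close>

text \<open>The p-th power of the seminorm as an extended nonnegative integral. It is meaningful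
  before integrability is known, so additivity and the convergence theorems can be used to prove
  membership in \<open>Lp\<close>.\<close>

definition Lp_power :: "real \<Rightarrow> real \<Rightarrow> real \<Rightarrow> (real \<Rightarrow> 'e::real_normed_vector) \<Rightarrow> ennreal" where
  "Lp_power p a b u = (\<integral>\<^sup>+x. ennreal (norm (u x) powr p) * indicator {a<..<b} x \<partial>lebesgue)"

lemma borel_measurable_indicator_norm_powr:
  fixes u :: "real \<Rightarrow> 'e::real_normed_vector"
  assumes "strongly_measurable (lebesgue_on {a<..<b}) u"
  shows "(\<lambda>x. (indicator {a<..<b} x * norm (u x)) powr p) \<in> borel_measurable lebesgue"
proof -
  define h where "h = (\<lambda>x. indicator {a<..<b} x * norm (u x))"
  have "h \<in> borel_measurable lebesgue"
    unfolding h_def using assms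
    by (intro strongly_measurable_imp_borel_measurable strongly_measurable_norm) auto
  then have "(\<lambda>x. h x powr p) \<in> borel_measurable lebesgue"
    by (intro powr_real_measurable) auto
  then show ?thesis by (simp add: h_def)
qed

lemma borel_measurable_norm_powr:
  fixes u :: "real \<Rightarrow> 'e::real_normed_vector"
  assumes "strongly_measurable (lebesgue_on {a<..<b}) u"
  shows "(\<lambda>x. ennreal (norm (u x) powr p) * indicator {a<..<b} x) \<in> borel_measurable lebesgue"
proof -
  define h where "h = (\<lambda>x. (indicator {a<..<b} x * norm (u x)) powr p)"
  have "h \<in> borel_measurable lebesgue"
    unfolding h_def by (rule borel_measurable_indicator_norm_powr[OF assms])
  then have "(\<lambda>x. ennreal (h x) * indicator {a<..<b} x) \<in> borel_measurable lebesgue"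
    by (intro borel_measurable_times_ennreal measurable_compose[OF _ measurable_ennreal] borel_measurable_indicator) auto
  then show ?thesis
    by (rule measurable_cong[THEN iffD1, rotated]) (auto simp: h_def indicator_def)
qed

text \<open>Strong measurability already makes the p-th power of the norm measurable, so
  integrability amounts to finiteness of the extended integral.\<close>

lemma Lp_iff: "u \<in> Lp p a b \<longleftrightarrow> strongly_measurable (lebesgue_on {a<..<b}) u \<and> Lp_power p a b u < \<infinity>"
proof (cases "strongly_measurable (lebesgue_on {a<..<b}) u")
  case True
  have "(\<lambda>x. norm (u x) powr p) \<in> borel_measurable (lebesgue_on {a<..<b})"
    using measurable_restrict_space1[OF borel_measurable_indicator_norm_powr[OF True, of p], of "{a<..<b}"]
    by (rule measurable_cong[THEN iffD1, rotated]) (auto simp: indicator_def)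
  then have "integrable (lebesgue_on {a<..<b}) (\<lambda>t. norm (u t) powr p) \<longleftrightarrow> Lp_power p a b u < \<infinity>"
    by (simp add: integrable_iff_bounded Lp_power_def nn_integral_restrict_space)
  then show ?thesis using True by (simp add: Lp_def)
qed (auto simp: Lp_def)

lemma LpD: "u \<in> Lp p a b \<Longrightarrow> strongly_measurable (lebesgue_on {a<..<b}) u"
  by (simp add: Lp_iff)

lemma Lp_norm_nonneg: "0 \<le> Lp_norm p a b u"
  by (simp add: Lp_norm_def)

lemma Lp_norm_minus_commute: "Lp_norm p a b (u - v) = Lp_norm p a b (v - u)"
  by (simp add: Lp_norm_def norm_minus_commute)

lemma AE_lebesgue_neq: "AE x in lebesgue. x \<noteq> (c::real)"
  by (rule AE_I'[where N = "{c}"]) auto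

lemma strongly_measurable_combine:
  assumes "strongly_measurable (lebesgue_on {a<..<b}) u" "strongly_measurable (lebesgue_on {b<..<c}) u"
  shows "strongly_measurable (lebesgue_on {a<..<c::real}) u"
proof (rule strongly_measurable_AE_subset)
  show "strongly_measurable (lebesgue_on ({a<..<b} \<union> {b<..<c})) u"
    using assms by (intro strongly_measurable_Un) auto
  show "AE t in lebesgue. t \<in> {a<..<c} \<longrightarrow> t \<in> {a<..<b} \<union> {b<..<c}"
    using AE_lebesgue_neq[of b] by eventually_elim auto
qed auto

lemma Lp_power_translation:
  assumes "strongly_measurable (lebesgue_on {a<..<b}) u"
  shows "Lp_power p (a - c) (b - c) (\<lambda>x. u (x + c)) = Lp_power p a b u"
proof -
  have "Lp_power p a b u = (\<integral>\<^sup>+x. ennreal (norm (u (x + c)) powr p) * indicator {a<..<b} (x + c) \<partial>lebesgue)"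
    unfolding Lp_power_def using borel_measurable_norm_powr[OF assms, of p]
    by (subst nn_integral_lebesgue_translation[symmetric, where c = c]) auto
  also have "\<dots> = Lp_power p (a - c) (b - c) (\<lambda>x. u (x + c))"
    unfolding Lp_power_def by (intro nn_integral_cong) (auto simp: indicator_def)
  finally show ?thesis by simp
qed

lemma Lp_power_combine:
  assumes "strongly_measurable (lebesgue_on {a<..<b}) u" "strongly_measurable (lebesgue_on {b<..<c}) u"
    "a \<le> b" "b \<le> c"
  shows "Lp_power p a c u = Lp_power p a b u + Lp_power p b c u"
proof -
  have "Lp_power p a c u = (\<integral>\<^sup>+x. ennreal (norm (u x) powr p) * indicator {a<..<b} x
      + ennreal (norm (u x) powr p) * indicator {b<..<c} x \<partial>lebesgue)"
    unfolding Lp_power_def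
  proof (rule nn_integral_cong_AE)
    show "AE x in lebesgue. ennreal (norm (u x) powr p) * indicator {a<..<c} x =
        ennreal (norm (u x) powr p) * indicator {a<..<b} x + ennreal (norm (u x) powr p) * indicator {b<..<c} x"
      using AE_lebesgue_neq[of b] by eventually_elim (use assms(3,4) in \<open>auto simp: indicator_def\<close>)
  qed
  then show ?thesis
    unfolding Lp_power_def using assms(1,2)
    by (subst (asm) nn_integral_add) (auto intro: borel_measurable_norm_powr)
qed

lemma Lp_combine:
  assumes "u \<in> Lp p a b" "u \<in> Lp p b c" "a \<le> b" "b \<le> c"
  shows "u \<in> Lp p a c"
  using assms strongly_measurable_combine[of a b u c] Lp_power_combine[of a b u c]
  by (auto simp: Lp_iff)

section \<open>Minkowski's inequality and operations on p-integrable functions\<close>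

context
  fixes p :: real
  assumes p: "1 \<le> p"
begin

lemma Lp_power_eq:
  assumes "u \<in> Lp p a b"
  shows "Lp_power p a b u = ennreal (Lp_norm p a b u powr p)"
proof -
  have i: "integrable (lebesgue_on {a<..<b}) (\<lambda>t. norm (u t) powr p)"
    using assms by (simp add: Lp_def)
  have "Lp_power p a b u = (\<integral>\<^sup>+x. ennreal (norm (u x) powr p) \<partial>lebesgue_on {a<..<b})"
    by (simp add: Lp_power_def nn_integral_restrict_space)
  also have "\<dots> = ennreal (integral\<^sup>L (lebesgue_on {a<..<b}) (\<lambda>t. norm (u t) powr p))"
    using i by (intro nn_integral_eq_integral) auto
  also have "integral\<^sup>L (lebesgue_on {a<..<b}) (\<lambda>t. norm (u t) powr p) = Lp_norm p a b u powr p"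
    using p by (simp add: Lp_norm_def powr_powr)
  finally show ?thesis .
qed

lemma Lp_norm_le_iff:
  assumes "u \<in> Lp p a b" "0 \<le> \<alpha>"
  shows "Lp_norm p a b u \<le> \<alpha> \<longleftrightarrow> Lp_power p a b u \<le> ennreal (\<alpha> powr p)"
proof
  assume "Lp_norm p a b u \<le> \<alpha>"
  then show "Lp_power p a b u \<le> ennreal (\<alpha> powr p)"
    using p Lp_norm_nonneg[of p a b u] by (simp add: Lp_power_eq[OF assms(1)] powr_mono2)
next
  assume "Lp_power p a b u \<le> ennreal (\<alpha> powr p)"
  then have "Lp_norm p a b u powr p \<le> \<alpha> powr p"
    by (simp add: Lp_power_eq[OF assms(1)])
  then show "Lp_norm p a b u \<le> \<alpha>"
    using p assms(2) powr_less_mono2[of p \<alpha> "Lp_norm p a b u"] by fastforce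
qed

lemma Lp_power_mono:
  assumes "AE x in lebesgue. x \<in> {a<..<b} \<longrightarrow> norm (u x) \<le> norm (v x)"
  shows "Lp_power p a b u \<le> Lp_power p a b v"
  unfolding Lp_power_def
proof (rule nn_integral_mono_AE)
  show "AE x in lebesgue. ennreal (norm (u x) powr p) * indicator {a<..<b} x
      \<le> ennreal (norm (v x) powr p) * indicator {a<..<b} x"
    using assms by eventually_elim (use p in \<open>auto simp: indicator_def intro!: ennreal_leI powr_mono2\<close>)
qed

lemma Lp_dominated:
  assumes "v \<in> Lp p a b" "strongly_measurable (lebesgue_on {a<..<b}) u"
    "AE x in lebesgue. x \<in> {a<..<b} \<longrightarrow> norm (u x) \<le> norm (v x)"
  shows "u \<in> Lp p a b" "Lp_norm p a b u \<le> Lp_norm p a b v"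
proof -
  show u: "u \<in> Lp p a b"
    using assms Lp_power_mono[OF assms(3)] by (auto simp: Lp_iff)
  show "Lp_norm p a b u \<le> Lp_norm p a b v"
    using Lp_power_mono[OF assms(3)]
    by (subst Lp_norm_le_iff[OF u Lp_norm_nonneg]) (simp add: Lp_power_eq[OF assms(1)])
qed

lemma Lp_AE_cong:
  assumes "v \<in> Lp p a b" "AE x in lebesgue. x \<in> {a<..<b} \<longrightarrow> u x = v x"
  shows "u \<in> Lp p a b" "Lp_norm p a b u = Lp_norm p a b v"
proof -
  have u: "strongly_measurable (lebesgue_on {a<..<b}) u"
    by (rule strongly_measurable_AE_cong[of _ v]) (use assms in \<open>auto simp: LpD\<close>)
  have le: "AE x in lebesgue. x \<in> {a<..<b} \<longrightarrow> norm (u x) \<le> norm (v x)"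
    "AE x in lebesgue. x \<in> {a<..<b} \<longrightarrow> norm (v x) \<le> norm (u x)"
    using assms(2) by auto
  show "u \<in> Lp p a b"
    by (rule Lp_dominated[OF assms(1) u le(1)])
  then show "Lp_norm p a b u = Lp_norm p a b v"
    using Lp_dominated(2)[OF assms(1) u le(1)] Lp_dominated(2)[OF _ _ le(2)] LpD[OF assms(1)] by force
qed

text \<open>This is convexity of the power function. A vanishing argument is treated apart: there
  the claim reduces to \<open>r powr p \<le> r\<close> for weights \<open>r\<close> in
  [0,1].\<close>

lemma powr_convex_combination:
  assumes "0 \<le> x" "0 \<le> y" "0 \<le> s" "0 \<le> t" "s + t = (1::real)"
  shows "(s * x + t * y) powr p \<le> s * x powr p + t * y powr p"
proof -
  have le: "(r * z) powr p \<le> r * z powr p" if "0 \<le> r" "r \<le> 1" "0 \<le> z" for r z :: real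
  proof -
    have "r powr p \<le> r powr 1" using that p by (intro powr_mono') auto
    then show ?thesis using that by (simp add: powr_mult mult_right_mono)
  qed
  show ?thesis
  proof (cases "x = 0 \<or> y = 0")
    case True
    then show ?thesis using le[of s x] le[of t y] assms p by auto
  next
    case False
    then have "((1 - t) * x + t * y) powr p \<le> (1 - t) * x powr p + t * y powr p"
      using convex_onD[OF powr_convex[OF p], of t x y] assms by simp
    moreover have "1 - t = s" using assms by simp
    ultimately show ?thesis by simp
  qed
qed

text \<open>The sum of the norms is \<open>\<alpha> + \<beta>\<close> times a convex combination of
  the normalized values \<open>norm x / \<alpha>\<close> and \<open>norm y / \<beta>\<close>. This
  pointwise form of Minkowski's inequality is ready for integration.\<close>

lemma norm_diff_powr_le:
  fixes x y :: "'e::real_normed_vector"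
  assumes "0 < \<alpha>" "0 < \<beta>"
  shows "norm (x - y) powr p \<le>
    (\<alpha> + \<beta>) powr p * (\<alpha> / (\<alpha> + \<beta>) * (norm x powr p / \<alpha> powr p) + \<beta> / (\<alpha> + \<beta>) * (norm y powr p / \<beta> powr p))"
proof -
  have "norm (x - y) powr p \<le> (norm x + norm y) powr p"
    using p by (intro powr_mono2 norm_triangle_ineq4) auto
  also have "norm x + norm y = (\<alpha> + \<beta>) * (\<alpha> / (\<alpha> + \<beta>) * (norm x / \<alpha>) + \<beta> / (\<alpha> + \<beta>) * (norm y / \<beta>))"
    using assms by (simp add: distrib_left)
  also have "\<dots> powr p = (\<alpha> + \<beta>) powr p * (\<alpha> / (\<alpha> + \<beta>) * (norm x / \<alpha>) + \<beta> / (\<alpha> + \<beta>) * (norm y / \<beta>)) powr p"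
    using assms by (intro powr_mult) 
  also have "(\<alpha> / (\<alpha> + \<beta>) * (norm x / \<alpha>) + \<beta> / (\<alpha> + \<beta>) * (norm y / \<beta>)) powr p
      \<le> \<alpha> / (\<alpha> + \<beta>) * (norm x / \<alpha>) powr p + \<beta> / (\<alpha> + \<beta>) * (norm y / \<beta>) powr p"
    using assms by (intro powr_convex_combination) (auto simp flip: add_divide_distrib)
  finally show ?thesis
    using assms by (simp add: powr_divide mult_left_mono)
qed

text \<open>Minkowski's inequality, in the form suited to distances. If \<open>\<alpha>\<close> and
  \<open>\<beta>\<close> exceed the two seminorms, integrating \<open>norm_diff_powr_le\<close>
  leaves \<open>(\<alpha> + \<beta>) powr p\<close>, because the weights add up to 1.\<close>

lemma Lp_diff:
  fixes u v :: "real \<Rightarrow> 'e::real_normed_vector"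
  assumes "u \<in> Lp p a b" "v \<in> Lp p a b"
  shows "u - v \<in> Lp p a b" "Lp_norm p a b (u - v) \<le> Lp_norm p a b u + Lp_norm p a b v"
proof -
  have sm: "strongly_measurable (lebesgue_on {a<..<b}) (u - v)"
    using assms LpD by (intro strongly_measurable_diff) auto
  \<comment> \<open>Strict bounds keep \<open>\<alpha>\<close> and \<open>\<beta>\<close> positive
    even if a seminorm vanishes; the excess tends to 0 at the end.\<close>
  have key: "Lp_power p a b (u - v) \<le> ennreal ((\<alpha> + \<beta>) powr p)"
    if \<alpha>: "Lp_norm p a b u < \<alpha>" and \<beta>: "Lp_norm p a b v < \<beta>" for \<alpha> \<beta>
  proof -
    have pos: "0 < \<alpha>" "0 < \<beta>"
      using \<alpha> \<beta> Lp_norm_nonneg[of p a b u] Lp_norm_nonneg[of p a b v] by linarith+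
    define c where "c = (\<alpha> + \<beta>) powr p * (\<alpha> / (\<alpha> + \<beta>)) / \<alpha> powr p"
    define d where "d = (\<alpha> + \<beta>) powr p * (\<beta> / (\<alpha> + \<beta>)) / \<beta> powr p"
    have cd: "0 \<le> c" "0 \<le> d" using pos by (auto simp: c_def d_def)
    have "Lp_power p a b (u - v) \<le> (\<integral>\<^sup>+x. ennreal c * (ennreal (norm (u x) powr p) * indicator {a<..<b} x)
        + ennreal d * (ennreal (norm (v x) powr p) * indicator {a<..<b} x) \<partial>lebesgue)"
      unfolding Lp_power_def
    proof (intro nn_integral_mono)
      fix x
      have "norm (u x - v x) powr p \<le> c * norm (u x) powr p + d * norm (v x) powr p"
        using norm_diff_powr_le[OF pos, of "u x" "v x"] by (simp add: c_def d_def algebra_simps)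
      then have "ennreal (norm (u x - v x) powr p) \<le> ennreal c * ennreal (norm (u x) powr p) + ennreal d * ennreal (norm (v x) powr p)"
        using cd by (simp flip: ennreal_mult ennreal_plus)
      then show "ennreal (norm ((u - v) x) powr p) * indicator {a<..<b} x \<le> ennreal c * (ennreal (norm (u x) powr p) * indicator {a<..<b} x)
        + ennreal d * (ennreal (norm (v x) powr p) * indicator {a<..<b} x)"
        by (auto simp: indicator_def)
    qed
    also have "\<dots> = ennreal c * Lp_power p a b u + ennreal d * Lp_power p a b v"
      unfolding Lp_power_def using assms[THEN LpD, THEN borel_measurable_norm_powr]
      by (subst nn_integral_add) (auto simp: nn_integral_cmult)
    also have "\<dots> \<le> ennreal c * ennreal (\<alpha> powr p) + ennreal d * ennreal (\<beta> powr p)"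
      using \<alpha> \<beta> pos Lp_norm_le_iff[OF assms(1), of \<alpha>] Lp_norm_le_iff[OF assms(2), of \<beta>]
      by (intro add_mono mult_left_mono) auto
    also have "\<dots> = ennreal (c * \<alpha> powr p + d * \<beta> powr p)"
      using cd by (simp add: ennreal_mult ennreal_plus)
    also have "c * \<alpha> powr p + d * \<beta> powr p = (\<alpha> + \<beta>) powr p * ((\<alpha> + \<beta>) / (\<alpha> + \<beta>))"
      unfolding add_divide_distrib distrib_left using pos by (simp add: c_def d_def)
    also have "\<dots> = (\<alpha> + \<beta>) powr p" using pos by simp
    finally show ?thesis .
  qed
  have "Lp_power p a b (u - v) < \<infinity>"
    using key[of "Lp_norm p a b u + 1" "Lp_norm p a b v + 1"] by (auto simp: le_less_trans)
  with sm show *: "u - v \<in> Lp p a b" by (simp add: Lp_iff)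
  show "Lp_norm p a b (u - v) \<le> Lp_norm p a b u + Lp_norm p a b v"
  proof (rule field_le_epsilon)
    fix e :: real assume "0 < e"
    then show "Lp_norm p a b (u - v) \<le> Lp_norm p a b u + Lp_norm p a b v + e"
      using key[of "Lp_norm p a b u + e/2" "Lp_norm p a b v + e/2"] Lp_norm_nonneg[of p a b u] Lp_norm_nonneg[of p a b v]
      by (subst Lp_norm_le_iff[OF *]) (auto simp: algebra_simps)
  qed
qed

lemma Lp_zero: "(\<lambda>_. 0 :: 'e::real_normed_vector) \<in> Lp p a b" "Lp_norm p a b (\<lambda>_. 0 :: 'e) = 0"
proof -
  have "Lp_power p a b (\<lambda>_. 0 :: 'e) = 0"
    using p by (simp add: Lp_power_def)
  moreover have "strongly_measurable (lebesgue_on {a<..<b}) (\<lambda>_. 0 :: 'e)"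
    by (intro strongly_measurable_simple) auto
  ultimately show "(\<lambda>_. 0 :: 'e) \<in> Lp p a b"
    by (simp add: Lp_iff)
qed (simp add: Lp_norm_def)

lemma Lp_norm_triangle:
  assumes "u \<in> Lp p a b" "v \<in> Lp p a b" "w \<in> Lp p a b"
  shows "Lp_norm p a b (u - w) \<le> Lp_norm p a b (u - v) + Lp_norm p a b (v - w)"
proof -
  have "u - w = (u - v) - (w - v)" by (auto simp: fun_eq_iff)
  then show ?thesis
    using Lp_diff(2)[OF Lp_diff(1)[OF assms(1,2)] Lp_diff(1)[OF assms(3,2)]] Lp_norm_minus_commute[of p a b v w]
    by simp
qed

lemma Lp_add:
  fixes u v :: "real \<Rightarrow> 'e::real_normed_vector"
  assumes "u \<in> Lp p a b" "v \<in> Lp p a b"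
  shows "(\<lambda>x. u x + v x) \<in> Lp p a b" "Lp_norm p a b (\<lambda>x. u x + v x) \<le> Lp_norm p a b u + Lp_norm p a b v"
proof -
  have *: "(\<lambda>x. u x + v x) = u - ((\<lambda>_. 0) - v)" by (auto simp: fun_eq_iff)
  have "(\<lambda>_. 0) - v \<in> Lp p a b" using Lp_diff(1)[OF Lp_zero(1) assms(2)] .
  moreover have "Lp_norm p a b ((\<lambda>_. 0) - v) = Lp_norm p a b v" by (simp add: Lp_norm_def)
  ultimately show "(\<lambda>x. u x + v x) \<in> Lp p a b"
      "Lp_norm p a b (\<lambda>x. u x + v x) \<le> Lp_norm p a b u + Lp_norm p a b v"
    unfolding * using Lp_diff[OF assms(1), of "(\<lambda>_. 0) - v"] by auto
qed

lemma Lp_sum: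
  fixes u :: "'i \<Rightarrow> real \<Rightarrow> 'e::real_normed_vector"
  assumes "finite I" "\<And>i. i \<in> I \<Longrightarrow> u i \<in> Lp p a b"
  shows "(\<lambda>x. \<Sum>i\<in>I. u i x) \<in> Lp p a b \<and> Lp_norm p a b (\<lambda>x. \<Sum>i\<in>I. u i x) \<le> (\<Sum>i\<in>I. Lp_norm p a b (u i))"
  using assms
proof (induction I)
  case empty
  then show ?case by (simp add: Lp_zero)
next
  case (insert i I)
  then show ?case
    using Lp_add[of "u i" a b "\<lambda>x. \<Sum>i\<in>I. u i x"] by auto
qed

lemma Lp_norm_real:
  assumes "u \<in> Lp p a b"
  shows "(\<lambda>x. norm (u x)) \<in> Lp p a b" "Lp_norm p a b (\<lambda>x. norm (u x)) = Lp_norm p a b u"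
proof -
  have "strongly_measurable (lebesgue_on {a<..<b}) (\<lambda>x. norm (u x))"
    using assms LpD by (intro strongly_measurable_norm) auto
  with assms show "(\<lambda>x. norm (u x)) \<in> Lp p a b"
    by (simp add: Lp_iff Lp_power_def)
qed (simp add: Lp_norm_def)

lemma Lp_translation:
  assumes "u \<in> Lp p a b"
  shows "(\<lambda>x. u (x + c)) \<in> Lp p (a - c) (b - c)"
    "Lp_norm p (a - c) (b - c) (\<lambda>x. u (x + c)) = Lp_norm p a b u"
proof -
  show *: "(\<lambda>x. u (x + c)) \<in> Lp p (a - c) (b - c)"
    using assms Lp_power_translation[of a b u p c] strongly_measurable_translation[of a b u c] by (auto simp: Lp_iff)
  have "ennreal (Lp_norm p (a - c) (b - c) (\<lambda>x. u (x + c)) powr p) = ennreal (Lp_norm p a b u powr p)"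
    using Lp_power_translation[OF LpD[OF assms], of p c] Lp_power_eq[OF assms] Lp_power_eq[OF *] by simp
  then have "Lp_norm p (a - c) (b - c) (\<lambda>x. u (x + c)) powr p = Lp_norm p a b u powr p"
    by (simp add: ennreal_inj)
  then have "(Lp_norm p (a - c) (b - c) (\<lambda>x. u (x + c)) powr p) powr (1 / p) = (Lp_norm p a b u powr p) powr (1 / p)"
    by simp
  then show "Lp_norm p (a - c) (b - c) (\<lambda>x. u (x + c)) = Lp_norm p a b u"
    using p Lp_norm_nonneg[of p a b u] Lp_norm_nonneg[of p "a - c" "b - c" "\<lambda>x. u (x + c)"]
    by (simp only: powr_powr) simp
qed

lemma Lp_mono:
  assumes "u \<in> Lp p a b" "a \<le> c" "d \<le> b"
  shows "u \<in> Lp p c d" "Lp_norm p c d u \<le> Lp_norm p a b u"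
proof -
  have le: "Lp_power p c d u \<le> Lp_power p a b u"
    unfolding Lp_power_def using assms by (intro nn_integral_mono) (auto simp: indicator_def)
  have "strongly_measurable (lebesgue_on {c<..<d}) u"
    by (rule strongly_measurable_AE_subset[OF _ LpD[OF assms(1)] _ AE_I2]) (use assms(2,3) in auto)
  then show *: "u \<in> Lp p c d" using le assms by (auto simp: Lp_iff)
  show "Lp_norm p c d u \<le> Lp_norm p a b u"
    using le by (subst Lp_norm_le_iff[OF * Lp_norm_nonneg]) (simp add: Lp_power_eq[OF assms(1)])
qed

lemma Lp_simple:
  fixes s :: "real \<Rightarrow> 'e::real_normed_vector"
  assumes "simple_function lebesgue s"
  shows "s \<in> Lp p a b"
proof -
  have fin: "finite (range s)" using assms by (auto simp: simple_function_def)
  then obtain M where M: "\<And>x. norm (s x) \<le> M"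
    by (meson finite_imp_bounded bounded_iff rangeI)
  have "Lp_power p a b s \<le> (\<integral>\<^sup>+x. ennreal (M powr p) * indicator {a<..<b} x \<partial>lebesgue)"
    unfolding Lp_power_def using M p
    by (intro nn_integral_mono) (auto simp: indicator_def intro!: ennreal_leI powr_mono2)
  also have "\<dots> < \<infinity>"
    proof -
    have "emeasure lebesgue {a<..<b} < \<infinity>" by (cases "a \<le> b") auto
    then show ?thesis
      by (subst nn_integral_cmult_indicator) (auto simp: ennreal_mult_less_top)
  qed
  finally show ?thesis
    using assms by (auto simp: Lp_iff intro: strongly_measurable_simple)
qed

end

section \<open>Density of simple functions, completeness and continuity of translation\<close>

text \<open>Regularity gives a compact \<open>K\<close> and an open \<open>U\<close> with
  \<open>K\<close> inside \<open>A\<close> inside \<open>U\<close> and both gaps of measure below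
  \<open>e/2\<close>. A shift shorter than \<open>d\<close> cannot move a point out of
  \<open>U\<close> into \<open>K\<close>; so \<open>x\<close> lies in \<open>U - A\<close>, or
  \<open>x + h\<close> lies in \<open>A - K\<close>, and the latter set of \<open>x\<close> has the
  measure of \<open>A - K\<close>.\<close>

lemma emeasure_translation_Diff_small:
  fixes A :: "real set"
  assumes A: "A \<in> sets lebesgue" "bounded A" and e: "0 < e"
  shows "\<exists>d>0. \<forall>h. \<bar>h\<bar> < d \<longrightarrow> emeasure lebesgue {x. x + h \<in> A \<and> x \<notin> A} \<le> ennreal e"
proof -
  obtain U where U: "open U" "A \<subseteq> U" "U - A \<in> lmeasurable" "emeasure lebesgue (U - A) < ennreal (e/2)"
    using sets_lebesgue_outer_open[OF A(1), of "e/2"] e by auto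
  obtain K where K: "closed K" "K \<subseteq> A" "A - K \<in> lmeasurable" "emeasure lebesgue (A - K) < ennreal (e/2)"
    using sets_lebesgue_inner_closed[OF A(1), of "e/2"] e by auto
  have "compact K" using K A(2) bounded_subset compact_eq_bounded_closed by blast
  then obtain d where d: "d > 0" "(\<Union>x\<in>K. ball x d) \<subseteq> U"
    using compact_subset_open_imp_ball_epsilon_subset[of K U] U K by blast
  have "emeasure lebesgue {x. x + h \<in> A \<and> x \<notin> A} \<le> ennreal e" if h: "\<bar>h\<bar> < d" for h
  proof -
    define T where "T = (\<lambda>x. x + h) -` (A - K) \<inter> space lebesgue"
    have T: "T \<in> sets lebesgue"
      unfolding T_def using K(3) by (intro measurable_sets[OF measurable_lebesgue_translation]) auto
    have "emeasure lebesgue T = emeasure (distr lebesgue lebesgue (\<lambda>x. x + h)) (A - K)"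
      unfolding T_def using K(3) by (intro emeasure_distr[symmetric] measurable_lebesgue_translation) auto
    then have eT: "emeasure lebesgue T = emeasure lebesgue (A - K)"
      by (simp only: distr_lebesgue_translation)
    have "{x. x + h \<in> A \<and> x \<notin> A} \<subseteq> (U - A) \<union> T"
    proof
      fix x assume x: "x \<in> {x. x + h \<in> A \<and> x \<notin> A}"
      show "x \<in> (U - A) \<union> T"
      proof (cases "x + h \<in> K")
        case True
        then have "x \<in> ball (x + h) d" using h by (simp add: dist_real_def)
        then show ?thesis using True d(2) x by blast
      qed (use x in \<open>auto simp: T_def\<close>)
    qed
    then have "emeasure lebesgue {x. x + h \<in> A \<and> x \<notin> A} \<le> emeasure lebesgue ((U - A) \<union> T)"
      using T U(3) by (intro emeasure_mono) auto
    also have "\<dots> \<le> emeasure lebesgue (U - A) + emeasure lebesgue T"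
      using T U(3) by (intro emeasure_subadditive) auto
    also have "\<dots> \<le> ennreal (e/2) + ennreal (e/2)"
      using U(4) K(4) unfolding eT by (intro add_mono) auto
    also have "\<dots> = ennreal e"
      using e by (simp flip: ennreal_plus)
    finally show ?thesis .
  qed
  then show ?thesis using d(1) by blast
qed

context
  fixes p :: real
  assumes p: "1 \<le> p"
begin

lemma Lp_simple_function_dense:
  fixes u :: "real \<Rightarrow> 'e::real_normed_vector"
  assumes u: "u \<in> Lp p a b" and e: "0 < e"
  shows "\<exists>s. simple_function lebesgue s \<and> Lp_norm p a b (u - s) < e"
proof -
  note sm = LpD[OF u]
  obtain s where s: "\<And>i. simple_function lebesgue (s i)"
    "AE t in lebesgue. t \<in> {a<..<b} \<longrightarrow> (\<lambda>i. s i t) \<longlonglongrightarrow> u t"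
    using strongly_measurableE[OF sm] by auto
  define h where "h = (\<lambda>x. indicator {a<..<b} x * norm (u x))"
  have h: "h \<in> borel_measurable lebesgue"
    unfolding h_def using sm by (intro strongly_measurable_imp_borel_measurable strongly_measurable_norm) auto
  \<comment> \<open>The truncation at twice the norm of u makes the approximation dominated.\<close>
  define r where "r = (\<lambda>i x. if norm (s i x) \<le> 2 * h x then s i x else 0)"
  have r: "simple_function lebesgue (r i)" for i
  proof -
    have "(\<lambda>x. norm (s i x)) \<in> borel_measurable lebesgue"
      by (rule borel_measurable_simple_function[OF simple_function_compose1[OF s(1)]])
    then have "{x \<in> space lebesgue. norm (s i x) \<le> 2 * h x} \<in> sets lebesgue"
      using borel_measurable_le[OF _ borel_measurable_times[OF borel_measurable_const h]] by blast
    then show ?thesis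
      unfolding r_def using s(1) by (intro simple_function_If) auto
  qed
  have rL: "u - r i \<in> Lp p a b" for i
    by (rule Lp_diff(1)[OF p u Lp_simple[OF p r]])
  have "(\<lambda>i. Lp_power p a b (u - r i)) \<longlonglongrightarrow> (\<integral>\<^sup>+x. 0 \<partial>(lebesgue :: real measure))"
    unfolding Lp_power_def
  proof (rule nn_integral_dominated_convergence)
    show "(\<lambda>x. ennreal (norm ((u - r i) x) powr p) * indicator {a<..<b} x) \<in> borel_measurable lebesgue" for i
      by (rule borel_measurable_norm_powr[OF LpD[OF rL]])
    \<comment> \<open>The majorant: on the interval
      \<open>norm (r i x) \<le> 2 * norm (u x)\<close>, so the difference is at most 1 + 2 = 3 times
      \<open>norm (u x)\<close>.\<close>
    show "(\<lambda>x. ennreal (3 powr p) * (ennreal (norm (u x) powr p) * indicator {a<..<b} x)) \<in> borel_measurable lebesgue"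
      by (rule borel_measurable_times_ennreal[OF borel_measurable_const borel_measurable_norm_powr[OF sm]])
    show "AE x in lebesgue. ennreal (norm ((u - r i) x) powr p) * indicator {a<..<b} x
        \<le> ennreal (3 powr p) * (ennreal (norm (u x) powr p) * indicator {a<..<b} x)" for i
    proof (rule AE_I2)
      fix x :: real
      have "norm ((u - r i) x) powr p \<le> 3 powr p * norm (u x) powr p" if "x \<in> {a<..<b}"
      proof -
        have "norm (r i x) \<le> 2 * norm (u x)" using that by (auto simp: r_def h_def)
        then have "norm ((u - r i) x) \<le> 3 * norm (u x)"
          using norm_triangle_ineq4[of "u x" "r i x"] by simp
        then have "norm ((u - r i) x) powr p \<le> (3 * norm (u x)) powr p"
          using p by (intro powr_mono2) auto
        then show ?thesis by (simp add: powr_mult)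
      qed
      then show "ennreal (norm ((u - r i) x) powr p) * indicator {a<..<b} x
        \<le> ennreal (3 powr p) * (ennreal (norm (u x) powr p) * indicator {a<..<b} x)"
        by (auto simp: indicator_def simp flip: ennreal_mult intro!: ennreal_leI)
    qed
    have "(\<integral>\<^sup>+ x. ennreal (3 powr p) * (ennreal (norm (u x) powr p) * indicator {a<..<b} x) \<partial>lebesgue)
        = ennreal (3 powr p) * Lp_power p a b u"
      unfolding Lp_power_def using borel_measurable_norm_powr[OF sm, of p] by (intro nn_integral_cmult) auto
    also have "\<dots> < \<infinity>" using u p by (auto simp: Lp_iff ennreal_mult_less_top)
    finally show "(\<integral>\<^sup>+ x. ennreal (3 powr p) * (ennreal (norm (u x) powr p) * indicator {a<..<b} x) \<partial>lebesgue) < \<infinity>" .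
    show "AE x in lebesgue. (\<lambda>i. ennreal (norm ((u - r i) x) powr p) * indicator {a<..<b} x) \<longlonglongrightarrow> 0"
      using s(2)
    proof eventually_elim
      case (elim x)
      show ?case
      proof (cases "x \<in> {a<..<b}")
        case True
        then have lim: "(\<lambda>i. s i x) \<longlonglongrightarrow> u x" and h: "h x = norm (u x)" using elim by (auto simp: h_def)
        \<comment> \<open>Where \<open>u x\<close> is nonzero the truncation is eventually inactive,
          because 2 > 1; at a zero of \<open>u\<close> it forces \<open>r i x = 0\<close>.\<close>
        have "(\<lambda>i. r i x) \<longlonglongrightarrow> u x"
        proof (cases "u x = 0")
          case True
          then have "r i x = 0" for i by (auto simp: r_def h)
          then show ?thesis using True by simp
        next
          case False
          have "eventually (\<lambda>i. norm (s i x) < 2 * norm (u x)) sequentially"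
            using tendsto_norm[OF lim] False by (intro order_tendstoD) auto
          then have "eventually (\<lambda>i. s i x = r i x) sequentially"
            by eventually_elim (auto simp: r_def h)
          then show ?thesis by (rule Lim_transform_eventually[OF lim])
        qed
        then have "(\<lambda>i. norm ((u - r i) x)) \<longlonglongrightarrow> norm (u x - u x)"
          unfolding minus_apply by (intro tendsto_intros)
        then have "(\<lambda>i. ennreal (norm ((u - r i) x) powr p)) \<longlonglongrightarrow> ennreal (0 powr p)"
          using p by (intro tendsto_ennrealI tendsto_powr') auto
        then show ?thesis using True p by simp
      qed simp
    qed
  qed auto
  then have "(\<lambda>i. Lp_power p a b (u - r i)) \<longlonglongrightarrow> 0" by simp
  moreover have "0 < ennreal ((e/2) powr p)" using e by simp
  ultimately have "eventually (\<lambda>i. Lp_power p a b (u - r i) < ennreal ((e/2) powr p)) sequentially"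
    by (rule order_tendstoD)
  then obtain i where "Lp_power p a b (u - r i) < ennreal ((e/2) powr p)"
    by (auto simp: eventually_sequentially)
  then have "Lp_norm p a b (u - r i) \<le> e/2"
    using e p rL by (subst Lp_norm_le_iff) auto
  with e show ?thesis by (intro exI[of _ "r i"]) (auto simp: r)
qed

text \<open>Lower semicontinuity of the seminorm under a.e. convergence. In
  \<open>Lp_complete\<close> it carries the Cauchy estimate over to the limit.\<close>

lemma Lp_Fatou:
  fixes w :: "nat \<Rightarrow> real \<Rightarrow> 'e::real_normed_vector"
  assumes "\<And>n. w n \<in> Lp p a b" "\<And>n. Lp_norm p a b (w n) \<le> C"
    and v: "strongly_measurable (lebesgue_on {a<..<b}) v"
    and lim: "AE x in lebesgue. x \<in> {a<..<b} \<longrightarrow> (\<lambda>n. w n x) \<longlonglongrightarrow> v x"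
  shows "v \<in> Lp p a b \<and> Lp_norm p a b v \<le> C"
proof -
  have C: "0 \<le> C" using assms(2) Lp_norm_nonneg by (rule order_trans[rotated])
  have le: "Lp_power p a b (w n) \<le> ennreal (C powr p)" for n
    using Lp_norm_le_iff[OF p assms(1) C] assms(2) by blast
  have "Lp_power p a b v = (\<integral>\<^sup>+x. liminf (\<lambda>n. ennreal (norm (w n x) powr p) * indicator {a<..<b} x) \<partial>lebesgue)"
    unfolding Lp_power_def
  proof (rule nn_integral_cong_AE)
    show "AE x in lebesgue. ennreal (norm (v x) powr p) * indicator {a<..<b} x =
        liminf (\<lambda>n. ennreal (norm (w n x) powr p) * indicator {a<..<b} x)"
      using lim
    proof eventually_elim
      case (elim x)
      have "(\<lambda>n. ennreal (norm (w n x) powr p) * indicator {a<..<b} x) \<longlonglongrightarrow> ennreal (norm (v x) powr p) * indicator {a<..<b} x"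
      proof (cases "x \<in> {a<..<b}")
        case True
        with elim have "(\<lambda>n. ennreal (norm (w n x) powr p)) \<longlonglongrightarrow> ennreal (norm (v x) powr p)"
          using p by (intro tendsto_ennrealI tendsto_powr' tendsto_norm) auto
        with True show ?thesis by simp
      qed simp
      then show ?case by (rule lim_imp_Liminf[OF sequentially_bot, symmetric])
    qed
  qed
  also have "\<dots> \<le> liminf (\<lambda>n. Lp_power p a b (w n))"
    unfolding Lp_power_def using borel_measurable_norm_powr[OF LpD[OF assms(1)]]
    by (intro nn_integral_liminf) auto
  also have "\<dots> \<le> ennreal (C powr p)"
    using le by (intro Liminf_le) auto
  finally have le: "Lp_power p a b v \<le> ennreal (C powr p)" .
  then have L: "v \<in> Lp p a b" using v p by (auto simp: Lp_iff le_less_trans)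
  with le C p show ?thesis by (simp add: Lp_norm_le_iff)
qed

text \<open>By monotone convergence the supremum of the p-th powers has integral at most
  \<open>C powr p\<close>, so it is finite a.e.\<close>

lemma AE_bounded_of_Lp_norm_bounded_mono:
  fixes F :: "nat \<Rightarrow> real \<Rightarrow> real"
  assumes F: "\<And>n. F n \<in> Lp p a b" "\<And>n. Lp_norm p a b (F n) \<le> C"
    and mono: "\<And>n x. 0 \<le> F n x" "\<And>n x. F n x \<le> F (Suc n) x"
  shows "AE x in lebesgue. x \<in> {a<..<b} \<longrightarrow> (\<exists>M. \<forall>n. F n x \<le> M)"
proof -
  define g where "g = (\<lambda>n x. ennreal (norm (F n x) powr p) * indicator {a<..<b} x)"
  have g: "g n \<in> borel_measurable lebesgue" for n
    unfolding g_def by (rule borel_measurable_norm_powr[OF LpD[OF F(1)]])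
  have C: "0 \<le> C" using F(2) Lp_norm_nonneg by (rule order_trans[rotated])
  have "(\<integral>\<^sup>+ x. (SUP n. g n x) \<partial>lebesgue) = (SUP n. integral\<^sup>N lebesgue (g n))"
  proof (rule nn_integral_monotone_convergence_SUP[OF _ g])
    show "incseq g"
      unfolding g_def using mono p
      by (intro incseq_SucI le_funI mult_right_mono ennreal_leI powr_mono2) auto
  qed
  also have "\<dots> \<le> ennreal (C powr p)"
    using Lp_norm_le_iff[OF p F(1) C] F(2) by (intro SUP_least) (simp add: g_def Lp_power_def)
  finally have "(\<integral>\<^sup>+ x. (SUP n. g n x) \<partial>lebesgue) \<noteq> \<infinity>"
    by (auto simp: top_unique)
  moreover have "(\<lambda>x. SUP n. g n x) \<in> borel_measurable lebesgue"
    using g by (intro borel_measurable_SUP) auto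
  ultimately have "AE x in lebesgue. (SUP n. g n x) \<noteq> \<infinity>"
    by (intro nn_integral_PInf_AE)
  then show ?thesis
  proof eventually_elim
    case (elim x)
    show ?case
    proof
      assume x: "x \<in> {a<..<b}"
      obtain M where M: "(SUP n. g n x) = ennreal M" "0 \<le> M"
        using elim by (cases "SUP n. g n x") auto
      have "F n x \<le> M powr (1/p)" for n
      proof -
        have "g n x \<le> ennreal M" unfolding M(1)[symmetric] by (rule SUP_upper) simp
        then have "F n x powr p \<le> M" using x M(2) mono(1)[of n x] by (simp add: g_def)
        then have "(F n x powr p) powr (1/p) \<le> M powr (1/p)" using p by (intro powr_mono2) auto
        then show ?thesis using p mono(1)[of n x] by (simp add: powr_powr)
      qed
      then show "\<exists>M. \<forall>n. F n x \<le> M" by blast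
    qed
  qed
qed

text \<open>The Riesz-Fischer argument for geometric increments. In the constant 7, the sum of the
  increments \<open>3 * (1/2) ^ k\<close> for \<open>k \<ge> n\<close> contributes 6, and the
  distance from \<open>v n\<close> to its simple approximation contributes 1.\<close>

lemma Lp_complete:
  fixes v :: "nat \<Rightarrow> real \<Rightarrow> 'e::banach"
  assumes v: "\<And>n. v n \<in> Lp p a b" "\<And>n. Lp_norm p a b (v (Suc n) - v n) \<le> (1/2) ^ n"
  shows "\<exists>w. w \<in> Lp p a b \<and> (\<forall>n. Lp_norm p a b (v n - w) \<le> 7 * (1/2) ^ n)"
proof -
  \<comment> \<open>Passing to simple functions makes the strong measurability of the pointwise limit immediate.\<close>
  have "\<exists>s. simple_function lebesgue s \<and> Lp_norm p a b (v n - s) < (1/2) ^ n" for n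
    using Lp_simple_function_dense[OF v(1)] by auto
  then obtain s where s: "\<And>n. simple_function lebesgue (s n)" "\<And>n. Lp_norm p a b (v n - s n) < (1/2) ^ n"
    by metis
  have sL: "s n \<in> Lp p a b" for n using p s(1) by (intro Lp_simple)
  have step: "Lp_norm p a b (s (Suc n) - s n) \<le> 3 * (1/2) ^ n" for n
  proof -
    have "Lp_norm p a b (s (Suc n) - s n) \<le> Lp_norm p a b (s (Suc n) - v (Suc n)) + Lp_norm p a b (v (Suc n) - s n)"
      using sL v(1) p by (intro Lp_norm_triangle)
    also have "\<dots> \<le> Lp_norm p a b (s (Suc n) - v (Suc n)) + (Lp_norm p a b (v (Suc n) - v n) + Lp_norm p a b (v n - s n))"
      using sL v(1) p by (intro add_left_mono Lp_norm_triangle)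
    also have "\<dots> \<le> (1/2) ^ Suc n + ((1/2) ^ n + (1/2) ^ n)"
      using s(2)[of n] s(2)[of "Suc n"] v(2)[of n] Lp_norm_minus_commute[of p a b "s (Suc n)"] by simp
    also have "\<dots> \<le> 3 * (1/2) ^ n" by simp
    finally show ?thesis .
  qed
  have far: "Lp_norm p a b (s n - s (n + m)) \<le> 6 * (1/2) ^ n" for n m
  proof -
    \<comment> \<open>The subtracted term makes the induction close, since
      \<open>3 * (1/2) ^ k = 6 * (1/2) ^ k - 6 * (1/2) ^ Suc k\<close>.\<close>
    have "Lp_norm p a b (s n - s (n + m)) \<le> 6 * (1/2) ^ n - 6 * (1/2) ^ (n + m)"
    proof (induction m)
      case 0
      have "s n - s (n + 0) = (\<lambda>_. 0)" by (auto simp: fun_eq_iff)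
      then show ?case by (simp only: Lp_zero(2)[OF p]) simp
    next
      case (Suc m)
      have "Lp_norm p a b (s n - s (n + Suc m)) \<le> Lp_norm p a b (s n - s (n + m)) + Lp_norm p a b (s (n + m) - s (n + Suc m))"
        using sL p by (intro Lp_norm_triangle)
      also have "Lp_norm p a b (s (n + m) - s (n + Suc m)) \<le> 3 * (1/2) ^ (n + m)"
        using step[of "n + m"] Lp_norm_minus_commute[of p a b "s (n + m)"] by simp
      finally show ?case using Suc by (simp only: add_Suc_right power_Suc) linarith
    qed
    also have "\<dots> \<le> 6 * (1/2) ^ n" by simp
    finally show ?thesis .
  qed
  define g where "g = (\<lambda>n x. norm (s (Suc n) x - s n x))"
  have g: "g n \<in> Lp p a b" "Lp_norm p a b (g n) \<le> 3 * (1/2) ^ n" for n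
    using Lp_norm_real[OF p Lp_diff(1)[OF p sL sL], of "Suc n" n] step[of n] by (auto simp: g_def)
  define F where "F = (\<lambda>n x. \<Sum>k<n. g k x)"
  have "AE x in lebesgue. x \<in> {a<..<b} \<longrightarrow> (\<exists>M. \<forall>n. F n x \<le> M)"
  proof (rule AE_bounded_of_Lp_norm_bounded_mono)
    fix n
    have "(\<lambda>x. \<Sum>k<n. g k x) \<in> Lp p a b \<and> Lp_norm p a b (\<lambda>x. \<Sum>k<n. g k x) \<le> (\<Sum>k<n. Lp_norm p a b (g k))"
      using p g by (intro Lp_sum) auto
    moreover have "(\<Sum>k<n. Lp_norm p a b (g k)) \<le> (\<Sum>k<n. 3 * (1/2) ^ k)"
      using g by (intro sum_mono)
    moreover have "(\<Sum>k<n. 3 * (1/2) ^ k :: real) \<le> 6"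
    proof -
      have "(\<Sum>k<n. 3 * (1/2) ^ k :: real) = 6 - 6 * (1/2) ^ n" by (induction n) auto
      then show ?thesis by simp
    qed
    ultimately show "F n \<in> Lp p a b" "Lp_norm p a b (F n) \<le> 6"
      by (auto simp: F_def)
  qed (auto simp: F_def g_def intro: sum_nonneg)
  then have conv: "AE x in lebesgue. x \<in> {a<..<b} \<longrightarrow> (\<lambda>n. s n x) \<longlonglongrightarrow> lim (\<lambda>n. s n x)"
  proof eventually_elim
    case (elim x)
    show ?case
    proof
      assume "x \<in> {a<..<b}"
      with elim obtain M where M: "\<And>n. F n x \<le> M" by blast
      have "summable (\<lambda>k. norm (s (Suc k) x - s k x))"
      proof (rule bounded_imp_summable)
        show "(\<Sum>k\<le>n. norm (s (Suc k) x - s k x)) \<le> M" for n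
          using M[of "Suc n"] by (simp add: F_def g_def lessThan_Suc_atMost del: sum.lessThan_Suc)
      qed simp
      then have "summable (\<lambda>k. s (Suc k) x - s k x)" by (rule summable_norm_cancel)
      then have "convergent (\<lambda>n. \<Sum>k<n. s (Suc k) x - s k x)" by (simp add: summable_iff_convergent)
      moreover have "(\<Sum>k<n. s (Suc k) x - s k x) = s n x - s 0 x" for n
        by (rule sum_lessThan_telescope)
      ultimately have "convergent (\<lambda>n. s n x - s 0 x)" by simp
      then have "convergent (\<lambda>n. s n x)" by (simp add: convergent_diff_const_right_iff)
      then show "(\<lambda>n. s n x) \<longlonglongrightarrow> lim (\<lambda>n. s n x)" by (simp add: convergent_LIMSEQ_iff)
    qed
  qed
  define w where "w = (\<lambda>x. lim (\<lambda>n. s n x))"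
  have wsm: "strongly_measurable (lebesgue_on {a<..<b}) w"
    by (rule strongly_measurableI[OF _ s(1)]) (use conv in \<open>auto simp: w_def\<close>)
  have sw: "s n - w \<in> Lp p a b \<and> Lp_norm p a b (s n - w) \<le> 6 * (1/2) ^ n" for n
  proof (rule Lp_Fatou)
    show "s n - s (n + m) \<in> Lp p a b" for m using sL p by (intro Lp_diff)
    show "Lp_norm p a b (s n - s (n + m)) \<le> 6 * (1/2) ^ n" for m by (rule far)
    show "strongly_measurable (lebesgue_on {a<..<b}) (s n - w)"
      using wsm LpD[OF sL] by (intro strongly_measurable_diff) auto
    show "AE x in lebesgue. x \<in> {a<..<b} \<longrightarrow> (\<lambda>m. (s n - s (n + m)) x) \<longlonglongrightarrow> (s n - w) x"
      using conv
    proof eventually_elim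
      case (elim x)
      show ?case
      proof
        assume "x \<in> {a<..<b}"
        then have "(\<lambda>m. s (m + n) x) \<longlonglongrightarrow> w x" using elim by (intro LIMSEQ_ignore_initial_segment) (auto simp: w_def)
        then show "(\<lambda>m. (s n - s (n + m)) x) \<longlonglongrightarrow> (s n - w) x"
          by (auto simp: add.commute intro!: tendsto_intros)
      qed
    qed
  qed
  have wL: "w \<in> Lp p a b"
  proof -
    have "w = s 0 - (s 0 - w)" by (auto simp: fun_eq_iff)
    then show ?thesis using Lp_diff(1)[OF p sL[of 0], of "s 0 - w"] sw[of 0] by auto
  qed
  have "Lp_norm p a b (v n - w) \<le> 7 * (1/2) ^ n" for n
    using Lp_norm_triangle[OF p v(1)[of n] sL[of n] wL] s(2)[of n] sw[of n] by simp
  with wL show ?thesis by blast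
qed

text \<open>If \<open>s (x + h)\<close> differs from \<open>s x\<close>, then \<open>x + h\<close>
  lies in the level set of the value \<open>s (x + h)\<close> and \<open>x\<close> does not. There
  are finitely many level sets, each contributes a set of small measure, and the jump is at most
  \<open>2 * M\<close>.\<close>

lemma simple_function_translation_continuous:
  fixes s :: "real \<Rightarrow> 'e::real_normed_vector"
  assumes s: "simple_function lebesgue s" and e: "0 < e"
  shows "\<exists>d>0. \<forall>h. \<bar>h\<bar> < d \<longrightarrow> Lp_norm p a b ((\<lambda>x. s (x + h)) - s) \<le> e"
proof -
  have fin: "finite (range s)" using s by (auto simp: simple_function_def)
  then obtain M where M: "\<And>x. norm (s x) \<le> M" "0 \<le> M"
    by (meson finite_imp_bounded bounded_pos rangeI less_imp_le)
  \<comment> \<open>Level sets are cut to be bounded, as the previous lemma on sets requires. The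
    margin 1 keeps \<open>x + h\<close> inside the cut for \<open>x\<close> in the interval, as
    \<open>d \<le> 1\<close>.\<close>
  define A where "A = (\<lambda>y. s -` {y} \<inter> {a-1<..<b+1})"
  have A: "A y \<in> sets lebesgue" for y
    using simple_functionD(2)[OF s, of "{y}"] unfolding A_def by auto
  have A_bounded: "bounded (A y)" for y
    by (rule bounded_subset[of "{a-1<..<b+1}"]) (auto simp: A_def)
  define c where "c = (2 * M) powr p * real (card (range s))"
  have c: "0 \<le> c" by (simp add: c_def)
  \<comment> \<open>Chosen so that \<open>c * e' \<le> e powr p\<close>; adding 1 keeps the
    denominator positive.\<close>
  define e' where "e' = e powr p / (c + 1)"
  have e': "0 < e'" using e c by (auto simp: e'_def)
  have "\<exists>d. d > 0 \<and> (\<forall>h. \<bar>h\<bar> < d \<longrightarrow> emeasure lebesgue {x. x + h \<in> A y \<and> x \<notin> A y} \<le> ennreal e')" for y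
    using emeasure_translation_Diff_small[OF A A_bounded e', of y] by blast
  then obtain D where D: "\<And>y. D y > 0"
      "\<And>y h. \<bar>h\<bar> < D y \<Longrightarrow> emeasure lebesgue {x. x + h \<in> A y \<and> x \<notin> A y} \<le> ennreal e'"
    by metis
  define d where "d = Min (insert 1 (D ` range s))"
  have d: "0 < d" "d \<le> 1" "\<And>y. y \<in> range s \<Longrightarrow> d \<le> D y"
    using fin D(1) unfolding d_def by (simp, simp, intro Min_le) auto
  have "Lp_norm p a b ((\<lambda>x. s (x + h)) - s) \<le> e" if h: "\<bar>h\<bar> < d" for h
  proof -
    have sh: "simple_function lebesgue (\<lambda>x. s (x + h))"
      by (rule simple_function_lebesgue_translation[OF s])
    have L: "(\<lambda>x. s (x + h)) - s \<in> Lp p a b"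
      using p s sh by (intro Lp_diff Lp_simple)
    define B where "B = (\<lambda>y. {x. x + h \<in> A y \<and> x \<notin> A y})"
    have B: "B y \<in> sets lebesgue" for y
    proof -
      have "B y = ((\<lambda>x. x + h) -` A y \<inter> space lebesgue) - A y" by (auto simp: B_def)
      then show ?thesis using A measurable_sets[OF measurable_lebesgue_translation A] by auto
    qed
    have "Lp_power p a b ((\<lambda>x. s (x + h)) - s) \<le> (\<integral>\<^sup>+x. ennreal ((2 * M) powr p) * (\<Sum>y\<in>range s. indicator (B y) x) \<partial>lebesgue)"
      unfolding Lp_power_def
    proof (rule nn_integral_mono)
      fix x :: real
      have le: "norm (s (x + h) - s x) powr p \<le> (2 * M) powr p"
        using M(1)[of x] M(1)[of "x + h"] norm_triangle_ineq4[of "s (x + h)" "s x"] p by (intro powr_mono2) auto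
      show "ennreal (norm (((\<lambda>x. s (x + h)) - s) x) powr p) * indicator {a<..<b} x
          \<le> ennreal ((2 * M) powr p) * (\<Sum>y\<in>range s. indicator (B y) x)"
      proof (cases "x \<in> {a<..<b} \<and> s (x + h) \<noteq> s x")
        case True
        then have "x \<in> B (s (x + h))" using h d(2) by (auto simp: B_def A_def)
        then have "1 \<le> (\<Sum>y\<in>range s. indicator (B y) x :: ennreal)"
          using member_le_sum[of "s (x + h)" "range s" "\<lambda>y. indicator (B y) x :: ennreal"] fin by auto
        then have "ennreal (norm (s (x + h) - s x) powr p) * 1 \<le> ennreal ((2 * M) powr p) * (\<Sum>y\<in>range s. indicator (B y) x)"
          using le by (intro mult_mono ennreal_leI) auto
        then show ?thesis using True by simp
      qed (use p in \<open>auto simp: indicator_def\<close>)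
    qed
    also have "\<dots> = ennreal ((2 * M) powr p) * (\<Sum>y\<in>range s. emeasure lebesgue (B y))"
      using B by (subst nn_integral_cmult) (auto simp: nn_integral_sum)
    also have "\<dots> \<le> ennreal ((2 * M) powr p) * (\<Sum>y\<in>range s. ennreal e')"
    proof (intro mult_left_mono sum_mono)
      fix y assume "y \<in> range s"
      then show "emeasure lebesgue (B y) \<le> ennreal e'"
        unfolding B_def using h d(3) by (intro D(2)) fastforce
    qed auto
    also have "\<dots> = ennreal (c * e')"
      using e' by (simp add: c_def ennreal_mult ennreal_of_nat_eq_real_of_nat mult.assoc)
    also have "\<dots> \<le> ennreal (e powr p)"
    proof (rule ennreal_leI)
      have "c * e' \<le> (c + 1) * e'" using e' by (intro mult_right_mono) auto
      also have "\<dots> = e powr p" using c by (simp add: e'_def)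
      finally show "c * e' \<le> e powr p" .
    qed
    finally show ?thesis using e p L by (subst Lp_norm_le_iff) auto
  qed
  then show ?thesis using d(1) by blast
qed

text \<open>A translation by less than 1 leaves the interval by less than 1. A simple approximation
  on \<open>(a - 1, b + 1)\<close> therefore has small error on \<open>(a, b)\<close> both before
  and after translation.\<close>

lemma Lp_translation_continuous:
  fixes u :: "real \<Rightarrow> 'e::real_normed_vector"
  assumes u: "u \<in> Lp_loc p" and e: "0 < e"
  shows "\<exists>d>0. \<forall>h. \<bar>h\<bar> < d \<longrightarrow> Lp_norm p a b ((\<lambda>x. u (x + h)) - u) \<le> e"
proof -
  have uL: "u \<in> Lp p c d" for c d using u by (simp add: Lp_loc_def)
  obtain s where s: "simple_function lebesgue s" "Lp_norm p (a-1) (b+1) (u - s) < e/3"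
    using Lp_simple_function_dense[OF uL, of "e/3"] e by auto
  have sL: "s \<in> Lp p c d" for c d by (rule Lp_simple[OF p s(1)])
  obtain d where d: "d > 0" "\<And>h. \<bar>h\<bar> < d \<Longrightarrow> Lp_norm p a b ((\<lambda>x. s (x + h)) - s) \<le> e/3"
    using simple_function_translation_continuous[OF s(1), of "e/3" a b] e by auto
  have "Lp_norm p a b ((\<lambda>x. u (x + h)) - u) \<le> e" if h: "\<bar>h\<bar> < min d 1" for h
  proof -
    have uh: "(\<lambda>x. u (x + h)) \<in> Lp p a b" and sh: "(\<lambda>x. s (x + h)) \<in> Lp p a b"
      using Lp_translation(1)[OF p uL, where c = h, of "a + h" "b + h"]
        Lp_translation(1)[OF p sL, where c = h, of "a + h" "b + h"] by auto
    have usL: "u - s \<in> Lp p c d" for c d by (rule Lp_diff(1)[OF p uL sL])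
    have "Lp_norm p a b ((\<lambda>x. u (x + h)) - (\<lambda>x. s (x + h))) = Lp_norm p (a + h) (b + h) (u - s)"
      using Lp_translation(2)[OF p usL, where c = h, of "a + h" "b + h"] by (simp add: fun_diff_def)
    also have "\<dots> \<le> Lp_norm p (a-1) (b+1) (u - s)"
      using h by (intro Lp_mono[OF p usL]) auto
    finally have 1: "Lp_norm p a b ((\<lambda>x. u (x + h)) - (\<lambda>x. s (x + h))) \<le> e/3" using s(2) by simp
    have 2: "Lp_norm p a b (u - s) \<le> e/3"
      using Lp_mono(2)[OF p usL, of "a-1" a b "b+1"] s(2) by auto
    have "Lp_norm p a b ((\<lambda>x. u (x + h)) - u) \<le> Lp_norm p a b ((\<lambda>x. u (x + h)) - (\<lambda>x. s (x + h)))
        + (Lp_norm p a b ((\<lambda>x. s (x + h)) - s) + Lp_norm p a b (s - u))"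
      by (intro order_trans[OF Lp_norm_triangle[OF p uh sh uL]] add_left_mono Lp_norm_triangle[OF p sh sL uL])
    then show ?thesis
      using 1 2 d(2)[of h] h Lp_norm_minus_commute[of p a b s u] by simp
  qed
  then show ?thesis using d(1) by (intro exI[of _ "min d 1"]) auto
qed

end

subsection \<open>Continuity near totally bounded sets\<close>

text \<open>If the uniform estimate fails on \<open>K\<close>, it fails on nested subsets of
  diameter at most \<open>(1/2) ^ n\<close>; these shrink to a point \<open>x\<close>, where
  continuity is contradicted. The point \<open>x\<close> may lie outside \<open>K\<close>, and only
  \<open>v\<close> is confined to \<open>K\<close>, so the estimate also covers every
  \<open>w\<close> in \<open>L\<close> near \<open>K\<close>.\<close>

lemma uniform_continuity_near_totally_bounded:
  fixes d \<rho> :: "'a \<Rightarrow> 'a \<Rightarrow> real"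
  assumes d_triangle: "\<And>x y z. x \<in> L \<Longrightarrow> y \<in> L \<Longrightarrow> z \<in> L \<Longrightarrow> d x z \<le> d x y + d y z"
    and d_sym: "\<And>x y. d x y = d y x"
    and \<rho>_triangle: "\<And>x y z. x \<in> L \<Longrightarrow> y \<in> L \<Longrightarrow> z \<in> L \<Longrightarrow> \<rho> y z \<le> \<rho> x y + \<rho> x z"
    and cont: "\<And>x e. x \<in> L \<Longrightarrow> 0 < e \<Longrightarrow> \<exists>\<delta>>0. \<forall>y\<in>L. d x y < \<delta> \<longrightarrow> \<rho> x y < e"
    and K: "K \<subseteq> L"
    and totally_bounded: "\<And>e. 0 < e \<Longrightarrow> \<exists>F. finite F \<and> F \<subseteq> L \<and> (\<forall>k\<in>K. \<exists>x\<in>F. d x k \<le> e)"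
    and complete: "\<And>v. (\<And>n. v n \<in> K) \<Longrightarrow> (\<And>n. d (v (Suc n)) (v n) \<le> (1/2) ^ n) \<Longrightarrow>
      \<exists>x\<in>L. \<forall>n. d x (v n) \<le> 7 * (1/2) ^ n"
    and e: "0 < e"
  shows "\<exists>\<delta>>0. \<forall>v\<in>K. \<forall>w\<in>L. d v w < \<delta> \<longrightarrow> \<rho> v w < e"
proof (rule ccontr)
  define bad where "bad = (\<lambda>B. B \<subseteq> K \<and> (\<forall>\<delta>>0. \<exists>v\<in>B. \<exists>w\<in>L. d v w < \<delta> \<and> e \<le> \<rho> v w))"
  assume "\<not> ?thesis"
  then have bad_K: "bad K"
    unfolding bad_def by (meson not_less order_refl)
  \<comment> \<open>If the estimate held on each of finitely many pieces covering \<open>B\<close>,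
    the smallest \<open>\<delta>\<close> would serve for all of \<open>B\<close>.\<close>
  have refine: "\<exists>B'. bad B' \<and> B' \<subseteq> B \<and> (\<forall>x\<in>B'. \<forall>y\<in>B'. d x y \<le> \<eta>)" if B: "bad B" and \<eta>: "0 < \<eta>" for B \<eta>
  proof (rule ccontr)
    assume no: "\<not> ?thesis"
    obtain F where F: "finite F" "F \<subseteq> L" "\<forall>k\<in>K. \<exists>x\<in>F. d x k \<le> \<eta>/2"
      using totally_bounded[of "\<eta>/2"] \<eta> by auto
    have BK: "B \<subseteq> K" using B by (simp add: bad_def)
    define P where "P = (\<lambda>x. {k\<in>B. d x k \<le> \<eta>/2})"
    have "\<not> bad (P x)" if "x \<in> F" for x
    proof
      assume "bad (P x)"
      moreover have "\<forall>y\<in>P x. \<forall>z\<in>P x. d y z \<le> \<eta>"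
      proof (intro ballI)
        fix y z assume yz: "y \<in> P x" "z \<in> P x"
        then have "d y z \<le> d y x + d x z"
          using that F(2) BK K by (intro d_triangle) (auto simp: P_def)
        then show "d y z \<le> \<eta>" using yz d_sym[of x y] by (auto simp: P_def)
      qed
      moreover have "P x \<subseteq> B" by (auto simp: P_def)
      ultimately show False using no by blast
    qed
    then have "\<forall>x\<in>F. \<exists>\<delta>>0. \<forall>v\<in>P x. \<forall>w\<in>L. d v w < \<delta> \<longrightarrow> \<rho> v w < e"
      using BK by (fastforce simp: bad_def P_def not_less)
    then obtain \<delta> where \<delta>: "\<forall>x\<in>F. \<delta> x > 0 \<and> (\<forall>v\<in>P x. \<forall>w\<in>L. d v w < \<delta> x \<longrightarrow> \<rho> v w < e)"
      by metis
    \<comment> \<open>The 1 keeps \<open>Min\<close> meaningful when \<open>F\<close> is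
      empty.\<close>
    define \<delta>' where "\<delta>' = Min (insert 1 (\<delta> ` F))"
    have "0 < \<delta>'" using \<delta> F(1) by (auto simp: \<delta>'_def)
    then obtain v w where vw: "v \<in> B" "w \<in> L" "d v w < \<delta>'" "e \<le> \<rho> v w"
      using B by (auto simp: bad_def)
    obtain x where x: "x \<in> F" "d x v \<le> \<eta>/2" using F(3) vw(1) BK by auto
    have "\<delta>' \<le> \<delta> x" unfolding \<delta>'_def using F(1) x(1) by (intro Min_le) auto
    then show False using \<delta> x vw by (fastforce simp: P_def)
  qed
  have "\<exists>B. \<forall>n. (bad (B n) \<and> (\<forall>x\<in>B n. \<forall>y\<in>B n. d x y \<le> (1/2) ^ n)) \<and> B (Suc n) \<subseteq> B n"
  proof (rule dependent_nat_choice)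
    show "\<exists>B. bad B \<and> (\<forall>x\<in>B. \<forall>y\<in>B. d x y \<le> (1/2) ^ 0)"
      using refine[OF bad_K, of 1] by auto
    show "\<exists>B'. (bad B' \<and> (\<forall>x\<in>B'. \<forall>y\<in>B'. d x y \<le> (1/2) ^ Suc n)) \<and> B' \<subseteq> B"
      if "bad B \<and> (\<forall>x\<in>B. \<forall>y\<in>B. d x y \<le> (1/2) ^ n)" for B n
      using refine[of B "(1/2) ^ Suc n"] that by auto
  qed
  then obtain B where B: "\<And>n. bad (B n)" "\<And>n x y. x \<in> B n \<Longrightarrow> y \<in> B n \<Longrightarrow> d x y \<le> (1/2) ^ n"
    "\<And>n. B (Suc n) \<subseteq> B n" by metis
  have "\<exists>v. v \<in> B n" for n using B(1)[of n] zero_less_one unfolding bad_def by blast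
  then obtain v where v: "\<And>n. v n \<in> B n" by metis
  have BL: "B n \<subseteq> K" "B n \<subseteq> L" for n using B(1)[of n] K by (auto simp: bad_def)
  have "\<exists>x\<in>L. \<forall>n. d x (v n) \<le> 7 * (1/2) ^ n"
  proof (rule complete)
    show "v n \<in> K" for n using v BL by blast
    show "d (v (Suc n)) (v n) \<le> (1/2) ^ n" for n
      using v[of n] v[of "Suc n"] B(3)[of n] by (intro B(2)) auto
  qed
  then obtain x where x: "x \<in> L" "\<And>n. d x (v n) \<le> 7 * (1/2) ^ n" by blast
  obtain \<delta> where \<delta>: "\<delta> > 0" "\<And>y. y \<in> L \<Longrightarrow> d x y < \<delta> \<Longrightarrow> \<rho> x y < e/2"
    using cont[OF x(1), of "e/2"] e by auto
  \<comment> \<open>The bound \<open>d x y \<le> (7 + 1) * (1/2) ^ n\<close> has to stay below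
    \<open>\<delta>/2\<close>.\<close>
  obtain n where n: "(1/2 :: real) ^ n < \<delta>/16"
    using real_arch_pow_inv[of "\<delta>/16" "1/2"] \<delta>(1) by auto
  obtain y w where yw: "y \<in> B n" "w \<in> L" "d y w < \<delta>/2" "e \<le> \<rho> y w"
    using B(1)[of n] \<delta>(1) unfolding bad_def by (meson half_gt_zero)
  have L: "y \<in> L" "v n \<in> L" using yw(1) v BL(2)[of n] by auto
  have "d x y \<le> d x (v n) + d (v n) y" by (rule d_triangle) (use x L in auto)
  also have "\<dots> < \<delta>/2" using x(2)[of n] B(2)[OF v yw(1)] n by linarith
  finally have xy: "d x y < \<delta>/2" .
  have "d x w \<le> d x y + d y w" by (rule d_triangle) (use x L yw in auto)
  then have "d x w < \<delta>" using xy yw(3) by linarith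
  then have "\<rho> x w < e/2" "\<rho> x y < e/2" using \<delta> xy L yw(2) by auto
  moreover have "\<rho> y w \<le> \<rho> x y + \<rho> x w" by (rule \<rho>_triangle) (use x L yw in auto)
  ultimately show False using yw(4) by linarith
qed

subsection \<open>Relatively dense sets\<close>

text \<open>Relative density brings every \<open>\<tau>\<close> into \<open>[0, l]\<close> by
  subtracting an element of \<open>T\<close>, and this compact interval has a finite net.\<close>

lemma relatively_dense_imp_finite_cover:
  assumes "relatively_dense T" "0 < \<eta>"
  shows "\<exists>S. finite S \<and> (\<forall>\<tau>. \<exists>s\<in>S. \<exists>x\<in>T. \<bar>\<tau> - s - x\<bar> < \<eta>)"
proof -
  obtain l where l: "l > 0" "\<And>a. {a..a + l} \<inter> T \<noteq> {}"
    using assms(1) by (auto simp: relatively_dense_def)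
  obtain S where S: "finite S" "{0..l} \<subseteq> (\<Union>s\<in>S. ball s \<eta>)"
    using compact_Icc[of 0 l] assms(2) unfolding compact_eq_totally_bounded by blast
  have "\<exists>s\<in>S. \<exists>x\<in>T. \<bar>\<tau> - s - x\<bar> < \<eta>" for \<tau>
  proof -
    obtain x where x: "x \<in> T" "\<tau> - l \<le> x" "x \<le> \<tau>" using l(2)[of "\<tau> - l"] by auto
    then have "\<tau> - x \<in> {0..l}" by auto
    then obtain s where "s \<in> S" "\<tau> - x \<in> ball s \<eta>" using S(2) by blast
    then show ?thesis using x(1) by (intro bexI[of _ s] bexI[of _ x]) (auto simp: dist_real_def)
  qed
  with S(1) show ?thesis by blast
qed

text \<open>Bochner's pigeonhole argument, by which finitely many almost periodic functions have common
  almost periods.\<close>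
lemma relatively_dense_common_differences:
  fixes A :: "'i \<Rightarrow> real set"
  assumes I: "finite I" and A: "\<And>i. i \<in> I \<Longrightarrow> \<exists>S. finite S \<and> (\<forall>\<tau>. \<exists>s\<in>S. \<tau> - s \<in> A i)"
  shows "relatively_dense {\<tau>. \<forall>i\<in>I. \<exists>x\<in>A i. \<exists>y\<in>A i. \<tau> = x - y}"
proof -
  have "\<exists>S. \<forall>i\<in>I. finite (S i) \<and> (\<forall>\<tau>. \<exists>s\<in>S i. \<tau> - s \<in> A i)"
    using A by (intro bchoice) blast
  then obtain S where S: "\<And>i. i \<in> I \<Longrightarrow> finite (S i)" "\<And>i \<tau>. i \<in> I \<Longrightarrow> \<exists>s\<in>S i. \<tau> - s \<in> A i"
    by blast
  define \<sigma> where "\<sigma> = (\<lambda>i \<tau>. SOME s. s \<in> S i \<and> \<tau> - s \<in> A i)"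
  have \<sigma>: "\<sigma> i \<tau> \<in> S i \<and> \<tau> - \<sigma> i \<tau> \<in> A i" if "i \<in> I" for i \<tau>
    unfolding \<sigma>_def by (rule someI_ex) (use S(2)[OF that] in blast)
  define \<pi> where "\<pi> = (\<lambda>\<tau>. restrict (\<lambda>i. \<sigma> i \<tau>) I)"
  have "range \<pi> \<subseteq> PiE I S" using \<sigma> by (auto simp: \<pi>_def)
  then have fin: "finite (range \<pi>)" by (rule finite_subset[OF _ finite_PiE[OF I S(1)]])
  \<comment> \<open>\<open>r\<close> selects one representative from each class of equal
    \<open>\<pi>\<close>. There are finitely many classes, so the representatives are bounded by
    some \<open>M\<close>, and \<open>?t - r ?t\<close> with \<open>?t = a + M\<close> falls into
    \<open>[a, a + 2 * M]\<close>.\<close>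
  define r where "r = (\<lambda>\<tau>. inv \<pi> (\<pi> \<tau>))"
  have r: "\<pi> (r \<tau>) = \<pi> \<tau>" for \<tau> by (simp add: r_def f_inv_into_f)
  have "range r = inv \<pi> ` range \<pi>" by (auto simp: r_def)
  then have "bounded (range r)" using fin by (intro finite_imp_bounded) auto
  then obtain M where M: "M > 0" "\<And>\<tau>. \<bar>r \<tau>\<bar> \<le> M" by (auto simp: bounded_pos)
  show ?thesis
    unfolding relatively_dense_def
  proof (intro exI[of _ "2 * M"] conjI allI)
    fix a
    let ?t = "a + M"
    have "?t - r ?t \<in> {a..a + 2 * M}" using M(2)[of ?t] by auto
    moreover have "\<exists>x\<in>A i. \<exists>y\<in>A i. ?t - r ?t = x - y" if "i \<in> I" for i
    proof -
      have "\<sigma> i (r ?t) = \<sigma> i ?t" using fun_cong[OF r[of ?t], of i] that by (simp add: \<pi>_def)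
      then show ?thesis using \<sigma>[OF that, of ?t] \<sigma>[OF that, of "r ?t"]
        by (intro bexI[of _ "?t - \<sigma> i ?t"] bexI[of _ "r ?t - \<sigma> i ?t"]) auto
    qed
    ultimately show "{a..a + 2 * M} \<inter> {\<tau>. \<forall>i\<in>I. \<exists>x\<in>A i. \<exists>y\<in>A i. \<tau> = x - y} \<noteq> {}" by blast
  qed (use M in auto)
qed

lemma relatively_dense_mono: "relatively_dense T \<Longrightarrow> T \<subseteq> T' \<Longrightarrow> relatively_dense T'"
  unfolding relatively_dense_def by blast

lemma relatively_dense_Ints: "relatively_dense (range real_of_int)"
  unfolding relatively_dense_def
proof (intro exI[of _ 1] conjI allI)
  fix a :: real
  have "real_of_int \<lceil>a\<rceil> \<in> {a..a + 1}" by (simp add: ceiling_correct less_imp_le)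
  then show "{a..a + 1} \<inter> range real_of_int \<noteq> {}" by blast
qed simp

subsection \<open>Stepanov almost periodic functions\<close>

lemma Lp_locD: "u \<in> Lp_loc p \<Longrightarrow> u \<in> Lp p a b"
  by (simp add: Lp_loc_def)

text \<open>For locally p-integrable \<open>u\<close> these are the Bohr almost periods of the
  Bochner transform, with the window (0,1) moved to \<open>(t, t + 1)\<close>.\<close>

definition almost_periods :: "real \<Rightarrow> (real \<Rightarrow> 'e::real_normed_vector) \<Rightarrow> real \<Rightarrow> real set" where
  "almost_periods p u e = {\<tau>. \<forall>t. Lp_norm p t (t + 1) ((\<lambda>x. u (x + \<tau>)) - u) \<le> e}"

context
  fixes p :: real
  assumes p: "1 \<le> p"
begin

lemma Lp_loc_diff: "u \<in> Lp_loc p \<Longrightarrow> v \<in> Lp_loc p \<Longrightarrow> u - v \<in> Lp_loc p"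
  using p by (simp add: Lp_loc_def Lp_diff)

lemma Lp_loc_translation:
  assumes "u \<in> Lp_loc p"
  shows "(\<lambda>x. u (x + c)) \<in> Lp_loc p"
proof -
  have "(\<lambda>x. u (x + c)) \<in> Lp p a b" for a b
    using Lp_translation(1)[OF p Lp_locD[OF assms], where c = c, of "a + c" "b + c"] by simp
  then show ?thesis by (simp add: Lp_loc_def)
qed

lemma Lp_norm_translation:
  assumes "u \<in> Lp_loc p"
  shows "Lp_norm p a b (\<lambda>x. u (x + c)) = Lp_norm p (a + c) (b + c) u"
  using Lp_translation(2)[OF p Lp_locD[OF assms], where c = c, of "a + c" "b + c"] by simp

lemma Lp_loc_const: "(\<lambda>_. x) \<in> Lp_loc p"
  using p by (simp add: Lp_loc_def Lp_simple)

text \<open>Periodizations and their images under the superposition operator are understood one unit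
  cell at a time; finitely many cells cover any bounded interval up to a null set.\<close>

lemma Lp_loc_grid:
  assumes "\<And>k::int. u \<in> Lp p (c + real_of_int k) (c + real_of_int k + 1)"
  shows "u \<in> Lp_loc p"
proof -
  have ind: "u \<in> Lp p (c + real_of_int k) (c + real_of_int k + real m)" for k :: int and m
  proof (induction m)
    case 0
    show ?case using Lp_mono(1)[OF p assms[of k]] by auto
  next
    case (Suc m)
    have "u \<in> Lp p (c + real_of_int k + real m) (c + real_of_int k + real m + 1)"
      using assms[of "k + int m"] by (simp add: add_ac)
    with Suc have "u \<in> Lp p (c + real_of_int k) (c + real_of_int k + real m + 1)"
      by (rule Lp_combine) auto
    then show ?case by (simp add: add_ac)
  qed
  have "u \<in> Lp p a b" for a b
  proof -
    obtain n where n: "max \<bar>a - c\<bar> \<bar>b - c\<bar> < real n" using reals_Archimedean2 by blast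
    show ?thesis
      using ind[of "- int n" "2 * n"] by (rule Lp_mono(1)[OF p]) (use n in auto)
  qed
  then show ?thesis by (simp add: Lp_loc_def)
qed

text \<open>For \<open>s \<le> t\<close>, the interval \<open>(s, t + 1)\<close> is split at
  \<open>t\<close> and at \<open>s + 1\<close>. By periodicity \<open>(s, t)\<close> and
  \<open>(s + 1, t + 1)\<close> contribute the same amount, which is finite and can be
  cancelled.\<close>

lemma Lp_norm_periodic:
  assumes u: "u \<in> Lp_loc p" and per: "\<And>x. u (x + 1) = u x"
  shows "Lp_norm p t (t + 1) u = Lp_norm p s (s + 1) u"
proof -
  note uL = Lp_locD[OF u] and sm = LpD[OF Lp_locD[OF u]]
  have "Lp_norm p t (t + 1) u = Lp_norm p s (s + 1) u" if "s \<le> t" for s t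
  proof -
    have "Lp_power p s t u + Lp_power p t (t + 1) u = Lp_power p s (t + 1) u"
      using that p by (intro Lp_power_combine[symmetric] sm) auto
    also have "\<dots> = Lp_power p s (s + 1) u + Lp_power p (s + 1) (t + 1) u"
      using that p by (intro Lp_power_combine sm) auto
    also have "Lp_power p (s + 1) (t + 1) u = Lp_power p s t u"
      using Lp_power_translation[OF sm, where c = 1, of p "s + 1" "t + 1"] per by simp
    finally have "Lp_power p t (t + 1) u = Lp_power p s (s + 1) u"
      using uL p by (simp add: Lp_iff add.commute[of _ "Lp_power p s t u"] ennreal_add_left_cancel)
        (metis less_irrefl infinity_ennreal_def)
    then have "ennreal (Lp_norm p t (t + 1) u powr p) = ennreal (Lp_norm p s (s + 1) u powr p)"
      by (simp add: Lp_power_eq[OF p uL])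
    then have "Lp_norm p t (t + 1) u powr p = Lp_norm p s (s + 1) u powr p" by simp
    then have "(Lp_norm p t (t + 1) u powr p) powr (1/p) = (Lp_norm p s (s + 1) u powr p) powr (1/p)" by simp
    then show ?thesis
      using p Lp_norm_nonneg[of p t "t + 1" u] Lp_norm_nonneg[of p s "s + 1" u]
      by (simp only: powr_powr) simp
  qed
  then show ?thesis by (metis linear)
qed

lemma Lp_norm_bochner_transform:
  assumes "u \<in> Lp_loc p"
  shows "Lp_norm p 0 1 (bochner_transform u t) = Lp_norm p t (t + 1) u"
  using Lp_norm_translation[OF assms, of 0 1 t] by (simp add: bochner_transform_def add.commute)

lemma Lp_norm_bochner_transform_diff:
  assumes "u \<in> Lp_loc p"
  shows "Lp_norm p 0 1 (bochner_transform u t - bochner_transform u s) =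
    Lp_norm p s (s + 1) ((\<lambda>x. u (x + (t - s))) - u)"
proof -
  have "bochner_transform u t - bochner_transform u s = bochner_transform ((\<lambda>x. u (x + (t - s))) - u) s"
    by (auto simp: bochner_transform_def fun_eq_iff algebra_simps)
  then show ?thesis
    using Lp_norm_bochner_transform[OF Lp_loc_diff[OF Lp_loc_translation[OF assms] assms]] by simp
qed

text \<open>Continuity of the transform is continuity of translation on a window. It holds for every
  locally p-integrable function, so it drops out of the descriptions of \<open>BSp\<close> and
  \<open>Sp_ap\<close> below.\<close>

lemma bochner_transform_continuous:
  assumes u: "u \<in> Lp_loc p"
  shows "range (bochner_transform u) \<subseteq> Lp p 0 1"
    "norm_continuous_on norm (Lp_norm p 0 1) UNIV (bochner_transform u)"
proof -
  show "range (bochner_transform u) \<subseteq> Lp p 0 1"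
    using Lp_locD[OF Lp_loc_translation[OF u]] by (auto simp: bochner_transform_def add.commute)
  show "norm_continuous_on norm (Lp_norm p 0 1) UNIV (bochner_transform u)"
    unfolding norm_continuous_on_def
  proof (intro ballI allI impI)
    fix t \<epsilon> :: real assume e: "0 < \<epsilon>"
    obtain d where d: "d > 0" "\<And>h. \<bar>h\<bar> < d \<Longrightarrow> Lp_norm p t (t + 1) ((\<lambda>x. u (x + h)) - u) \<le> \<epsilon>/2"
      using Lp_translation_continuous[OF p u, of "\<epsilon>/2" t "t + 1"] e by auto
    show "\<exists>\<delta>>0. \<forall>y\<in>UNIV. norm (y - t) < \<delta> \<longrightarrow> Lp_norm p 0 1 (bochner_transform u y - bochner_transform u t) < \<epsilon>"
      using d e by (intro exI[of _ d]) (auto simp: Lp_norm_bochner_transform_diff[OF u] intro!: le_less_trans[OF d(2)])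
  qed
qed

lemma BSp_iff: "u \<in> BSp p \<longleftrightarrow> u \<in> Lp_loc p \<and> (\<exists>B. \<forall>t. Lp_norm p t (t + 1) u \<le> B)"
  by (cases "u \<in> Lp_loc p") (simp_all add: BSp_def BC_def bochner_transform_continuous Lp_norm_bochner_transform)

lemma Sp_ap_iff: "u \<in> Sp_ap p \<longleftrightarrow> u \<in> Lp_loc p \<and> (\<forall>e>0. relatively_dense (almost_periods p u e))"
proof (cases "u \<in> Lp_loc p")
  case True
  have "{\<tau>. (SUP t. ereal (Lp_norm p 0 1 (bochner_transform u (t + \<tau>) - bochner_transform u t))) \<le> ereal e}
      = almost_periods p u e" for e
    by (auto simp: almost_periods_def Lp_norm_bochner_transform_diff[OF True] SUP_le_iff)
  then show ?thesis
    using True bochner_transform_continuous[OF True] by (auto simp: Sp_ap_def AP_def)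
qed (simp add: Sp_ap_def)

lemma Sp_norm_eq: "u \<in> Lp_loc p \<Longrightarrow> Sp_norm p u = (SUP t. Lp_norm p t (t + 1) u)"
  by (simp add: Sp_norm_def Lp_norm_bochner_transform)

lemma Sp_norm_le:
  assumes "u \<in> Lp_loc p" "\<And>t. Lp_norm p t (t + 1) u \<le> e"
  shows "Sp_norm p u \<le> e"
  unfolding Sp_norm_eq[OF assms(1)] using assms(2) by (intro cSUP_least) auto

lemma Lp_norm_le_Sp_norm:
  assumes "u \<in> BSp p"
  shows "Lp_norm p t (t + 1) u \<le> Sp_norm p u"
proof -
  have u: "u \<in> Lp_loc p" and "bdd_above (range (\<lambda>t. Lp_norm p t (t + 1) u))"
    using assms by (auto simp: BSp_iff bdd_above_def)
  then show ?thesis unfolding Sp_norm_eq[OF u] by (intro cSUP_upper) auto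
qed

lemma BSp_diff:
  assumes "u \<in> BSp p" "v \<in> BSp p"
  shows "u - v \<in> BSp p"
proof -
  have L: "u \<in> Lp_loc p" "v \<in> Lp_loc p" using assms by (auto simp: BSp_iff)
  have "Lp_norm p t (t + 1) (u - v) \<le> Sp_norm p u + Sp_norm p v" for t
    using Lp_diff(2)[OF p Lp_locD[OF L(1)] Lp_locD[OF L(2)], of t "t + 1"]
      Lp_norm_le_Sp_norm[OF assms(1), of t] Lp_norm_le_Sp_norm[OF assms(2), of t] by linarith
  then show ?thesis using Lp_loc_diff[OF L] by (auto simp: BSp_iff)
qed

lemma Sp_norm_triangle:
  assumes "u \<in> BSp p" "v \<in> BSp p" "w \<in> BSp p"
  shows "Sp_norm p (u - w) \<le> Sp_norm p (u - v) + Sp_norm p (v - w)"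
proof (rule Sp_norm_le)
  have L: "u \<in> Lp_loc p" "v \<in> Lp_loc p" "w \<in> Lp_loc p" using assms by (auto simp: BSp_iff)
  show "u - w \<in> Lp_loc p" using L by (intro Lp_loc_diff)
  show "Lp_norm p t (t + 1) (u - w) \<le> Sp_norm p (u - v) + Sp_norm p (v - w)" for t
    using Lp_norm_triangle[OF p L[THEN Lp_locD], of t "t + 1"]
      Lp_norm_le_Sp_norm[OF BSp_diff[OF assms(1,2)], of t] Lp_norm_le_Sp_norm[OF BSp_diff[OF assms(2,3)], of t]
    by linarith
qed

lemma Sp_norm_minus_commute: "Sp_norm p (u - v) = Sp_norm p (v - u)"
proof -
  have "bochner_transform (u - v) t = bochner_transform u t - bochner_transform v t" for u v :: "real \<Rightarrow> 'e::real_normed_vector" and t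
    by (auto simp: bochner_transform_def)
  then show ?thesis
    unfolding Sp_norm_def using Lp_norm_minus_commute by metis
qed

text \<open>Both errors occur on the window shifted by \<open>- \<sigma>\<close>, and the tolerances
  hold on all windows. The pigeonhole lemma produces differences, which this turns back into almost
  periods.\<close>

lemma almost_periods_diff:
  assumes u: "u \<in> Lp_loc p" and \<tau>: "\<tau> \<in> almost_periods p u e" and \<sigma>: "\<sigma> \<in> almost_periods p u e'"
  shows "\<tau> - \<sigma> \<in> almost_periods p u (e + e')"
  unfolding almost_periods_def
proof (intro CollectI allI)
  fix t
  note tr = Lp_loc_translation[OF u]
  have "Lp_norm p t (t + 1) ((\<lambda>x. u (x + (\<tau> - \<sigma>))) - u)
      \<le> Lp_norm p t (t + 1) ((\<lambda>x. u (x + (\<tau> - \<sigma>))) - (\<lambda>x. u (x + - \<sigma>))) + Lp_norm p t (t + 1) ((\<lambda>x. u (x + - \<sigma>)) - u)"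
    by (intro Lp_norm_triangle[OF p] Lp_locD tr u)
  also have "Lp_norm p t (t + 1) ((\<lambda>x. u (x + (\<tau> - \<sigma>))) - (\<lambda>x. u (x + - \<sigma>))) =
      Lp_norm p (t - \<sigma>) (t - \<sigma> + 1) ((\<lambda>x. u (x + \<tau>)) - u)"
    using Lp_norm_translation[OF Lp_loc_diff[OF tr[of \<tau>] u], of t "t + 1" "- \<sigma>"]
    by (simp add: fun_diff_def algebra_simps)
  also have "Lp_norm p t (t + 1) ((\<lambda>x. u (x + - \<sigma>)) - u) = Lp_norm p t (t + 1) (u - (\<lambda>x. u (x + - \<sigma>)))"
    by (rule Lp_norm_minus_commute)
  also have "\<dots> = Lp_norm p (t - \<sigma>) (t - \<sigma> + 1) ((\<lambda>x. u (x + \<sigma>)) - u)"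
    using Lp_norm_translation[OF Lp_loc_diff[OF tr[of \<sigma>] u], of t "t + 1" "- \<sigma>"]
    by (simp add: fun_diff_def algebra_simps)
  finally show "Lp_norm p t (t + 1) ((\<lambda>x. u (x + (\<tau> - \<sigma>))) - u) \<le> e + e'"
    by (rule order_trans) (use \<tau> \<sigma> in \<open>intro add_mono, simp_all only: almost_periods_def mem_Collect_eq\<close>)
qed

text \<open>Uniform continuity in Bohr's manner: an almost period carries an arbitrary window into
  \<open>(0, l + 1)\<close>, where continuity of translation applies. Moving there and back costs
  \<open>e/3\<close> each.\<close>

lemma small_translations_almost_periods:
  assumes "u \<in> Sp_ap p" "0 < e"
  shows "\<exists>d>0. \<forall>h. \<bar>h\<bar> < d \<longrightarrow> h \<in> almost_periods p u e"
proof -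
  have u: "u \<in> Lp_loc p" and "relatively_dense (almost_periods p u (e/3))"
    using assms by (auto simp: Sp_ap_iff)
  then obtain l where l: "l > 0" "\<And>a. {a..a + l} \<inter> almost_periods p u (e/3) \<noteq> {}"
    by (auto simp: relatively_dense_def)
  obtain d where d: "d > 0" "\<And>h. \<bar>h\<bar> < d \<Longrightarrow> Lp_norm p 0 (l + 1) ((\<lambda>x. u (x + h)) - u) \<le> e/3"
    using Lp_translation_continuous[OF p u, of "e/3" 0 "l + 1"] assms(2) by auto
  note tr = Lp_loc_translation[OF u]
  have "h \<in> almost_periods p u e" if h: "\<bar>h\<bar> < d" for h
    unfolding almost_periods_def
  proof (intro CollectI allI)
    fix t
    obtain \<tau> where \<tau>: "\<tau> \<in> almost_periods p u (e/3)" "- t \<le> \<tau>" "\<tau> \<le> - t + l"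
      using l(2)[of "- t"] by auto
    have per: "Lp_norm p s (s + 1) ((\<lambda>x. u (x + \<tau>)) - u) \<le> e/3" for s
      using \<tau>(1) by (simp add: almost_periods_def)
    have "Lp_norm p t (t + 1) ((\<lambda>x. u (x + h)) - u)
      \<le> Lp_norm p t (t + 1) ((\<lambda>x. u (x + h)) - (\<lambda>x. u (x + (h + \<tau>))))
        + (Lp_norm p t (t + 1) ((\<lambda>x. u (x + (h + \<tau>))) - (\<lambda>x. u (x + \<tau>))) + Lp_norm p t (t + 1) ((\<lambda>x. u (x + \<tau>)) - u))"
      by (intro order_trans[OF Lp_norm_triangle[OF p Lp_locD[OF tr] Lp_locD[OF tr[of "h + \<tau>"]] Lp_locD[OF u]]]
          add_left_mono Lp_norm_triangle[OF p] Lp_locD tr u)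
    also have "Lp_norm p t (t + 1) ((\<lambda>x. u (x + h)) - (\<lambda>x. u (x + (h + \<tau>)))) =
        Lp_norm p t (t + 1) ((\<lambda>x. u (x + (h + \<tau>))) - (\<lambda>x. u (x + h)))"
      by (rule Lp_norm_minus_commute)
    also have "\<dots> = Lp_norm p (t + h) (t + h + 1) ((\<lambda>x. u (x + \<tau>)) - u)"
      using Lp_norm_translation[OF Lp_loc_diff[OF tr[of \<tau>] u], of t "t + 1" h]
      by (simp add: fun_diff_def algebra_simps)
    also have "Lp_norm p t (t + 1) ((\<lambda>x. u (x + (h + \<tau>))) - (\<lambda>x. u (x + \<tau>))) =
        Lp_norm p (t + \<tau>) (t + \<tau> + 1) ((\<lambda>x. u (x + h)) - u)"
      using Lp_norm_translation[OF Lp_loc_diff[OF tr[of h] u], of t "t + 1" \<tau>]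
      by (simp add: fun_diff_def algebra_simps)
    finally have "Lp_norm p t (t + 1) ((\<lambda>x. u (x + h)) - u) \<le>
        e/3 + (Lp_norm p (t + \<tau>) (t + \<tau> + 1) ((\<lambda>x. u (x + h)) - u) + e/3)"
      using per[of "t + h"] per[of t] by linarith
    also have "Lp_norm p (t + \<tau>) (t + \<tau> + 1) ((\<lambda>x. u (x + h)) - u) \<le> Lp_norm p 0 (l + 1) ((\<lambda>x. u (x + h)) - u)"
      by (rule Lp_mono(2)[OF p Lp_locD[OF Lp_loc_diff[OF tr u]]]) (use \<tau> in auto)
    also have "\<dots> \<le> e/3" by (rule d(2)[OF h])
    finally show "Lp_norm p t (t + 1) ((\<lambda>x. u (x + h)) - u) \<le> e" by simp
  qed
  with d(1) show ?thesis by blast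
qed

text \<open>Bochner's criterion: the translates of \<open>u\<close> have a finite net. Each
  \<open>\<tau>\<close> is a net point plus an almost period plus a small shift, and the last two
  cost \<open>e/2\<close> each.\<close>

lemma Sp_ap_totally_bounded:
  assumes "u \<in> Sp_ap p" "0 < e"
  shows "\<exists>S. finite S \<and> (\<forall>\<tau>. \<exists>s\<in>S. \<tau> - s \<in> almost_periods p u e)"
proof -
  have u: "u \<in> Lp_loc p" and rd: "relatively_dense (almost_periods p u (e/2))"
    using assms by (auto simp: Sp_ap_iff)
  obtain d where d: "d > 0" "\<And>h. \<bar>h\<bar> < d \<Longrightarrow> h \<in> almost_periods p u (e/2)"
    using small_translations_almost_periods[OF assms(1), of "e/2"] assms(2) by auto
  obtain S where S: "finite S" "\<And>\<tau>. \<exists>s\<in>S. \<exists>x\<in>almost_periods p u (e/2). \<bar>\<tau> - s - x\<bar> < d"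
    using relatively_dense_imp_finite_cover[OF rd d(1)] by blast
  have "\<exists>s\<in>S. \<tau> - s \<in> almost_periods p u e" for \<tau>
  proof -
    obtain s x where sx: "s \<in> S" "x \<in> almost_periods p u (e/2)" "\<bar>\<tau> - s - x\<bar> < d"
      using S(2)[of \<tau>] by blast
    have "\<bar>x - (\<tau> - s)\<bar> < d" using sx(3) by linarith
    from almost_periods_diff[OF u sx(2) d(2)[OF this]] show ?thesis using sx(1) by auto
  qed
  with S(1) show ?thesis by blast
qed

lemma Lp_norm_almost_period:
  assumes "u \<in> Lp_loc p" "\<tau> - s \<in> almost_periods p u e"
  shows "Lp_norm p t (t + 1) ((\<lambda>x. u (x + \<tau>)) - (\<lambda>x. u (x + s))) \<le> e"
proof -
  have "Lp_norm p t (t + 1) ((\<lambda>x. u (x + \<tau>)) - (\<lambda>x. u (x + s))) =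
      Lp_norm p (t + s) (t + s + 1) ((\<lambda>x. u (x + (\<tau> - s))) - u)"
    using Lp_norm_translation[OF Lp_loc_diff[OF Lp_loc_translation[OF assms(1), of "\<tau> - s"] assms(1)], of t "t + 1" s]
    by (simp add: fun_diff_def algebra_simps)
  then show ?thesis using assms(2) by (simp add: almost_periods_def)
qed

text \<open>Every window of \<open>u\<close> is within distance 1 of one of finitely many
  windows.\<close>

lemma Sp_ap_subset_BSp: "Sp_ap p \<subseteq> BSp p"
proof
  fix u :: "real \<Rightarrow> 'e::real_normed_vector" assume ap: "u \<in> Sp_ap p"
  then have u: "u \<in> Lp_loc p" by (simp add: Sp_ap_iff)
  obtain S where S: "finite S" "\<And>\<tau>. \<exists>s\<in>S. \<tau> - s \<in> almost_periods p u 1"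
    using Sp_ap_totally_bounded[OF ap, of 1] by auto
  define B where "B = (\<Sum>s\<in>S. Lp_norm p s (s + 1) u)"
  have "Lp_norm p t (t + 1) u \<le> 1 + B" for t
  proof -
    obtain s where s: "s \<in> S" "t - s \<in> almost_periods p u 1" using S(2) by blast
    note tr = Lp_loc_translation[OF u]
    have "Lp_norm p 0 1 (\<lambda>x. u (x + t)) \<le>
        Lp_norm p 0 1 ((\<lambda>x. u (x + t)) - (\<lambda>x. u (x + s))) + Lp_norm p 0 1 (\<lambda>x. u (x + s))"
      using Lp_norm_triangle[OF p Lp_locD[OF tr[of t]] Lp_locD[OF tr[of s]] Lp_locD[OF Lp_loc_const[of 0]], of 0 1]
      by (simp add: fun_diff_def)
    also have "Lp_norm p 0 1 ((\<lambda>x. u (x + t)) - (\<lambda>x. u (x + s))) \<le> 1"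
      using Lp_norm_almost_period[OF u s(2), of 0] by simp
    also have "Lp_norm p 0 1 (\<lambda>x. u (x + s)) \<le> B"
    proof -
      have "Lp_norm p s (s + 1) u \<le> B"
        unfolding B_def by (rule member_le_sum) (use s(1) S(1) Lp_norm_nonneg in auto)
      then show ?thesis unfolding Lp_norm_translation[OF u] by (simp add: add.commute[of 1])
    qed
    finally show ?thesis unfolding Lp_norm_translation[OF u] by (simp add: add.commute)
  qed
  then show "u \<in> BSp p" using u by (auto simp: BSp_iff)
qed

text \<open>The a.e. identity iterates, so every integer is an almost period for every positive
  tolerance.\<close>

lemma Lp_per_subset_Sp_ap: "Lp_per p \<subseteq> Sp_ap p"
proof
  fix u :: "real \<Rightarrow> 'e::real_normed_vector" assume "u \<in> Lp_per p"
  then have u: "u \<in> Lp_loc p" and per: "AE x in lebesgue. u (x + 1) = u x"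
    by (auto simp: Lp_per_def)
  have nat: "AE x in lebesgue. u (x + real n) = u x" for n
  proof (induction n)
    case (Suc n)
    show ?case using AE_lebesgue_translation[OF per, of "real n"] Suc
      by eventually_elim (simp add: add_ac)
  qed simp
  have nat': "AE x in lebesgue. u (x - real n) = u x" for n
    using AE_lebesgue_translation[OF nat[of n], of "- real n"] by eventually_elim simp
  have int: "AE x in lebesgue. u (x + real_of_int k) = u x" for k
    using nat[of "nat k"] nat'[of "nat (- k)"] by (cases "k \<ge> 0") (auto simp: of_nat_nat)
  have "real_of_int k \<in> almost_periods p u e" if "0 < e" for k e
    unfolding almost_periods_def
  proof (intro CollectI allI)
    fix t
    have "AE x in lebesgue. x \<in> {t<..<t + 1} \<longrightarrow> ((\<lambda>x. u (x + real_of_int k)) - u) x = 0"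
      using int[of k] by eventually_elim simp
    then have "Lp_norm p t (t + 1) ((\<lambda>x. u (x + real_of_int k)) - u) = 0"
      by (rule trans[OF Lp_AE_cong(2)[OF p Lp_zero(1)[OF p]] Lp_zero(2)[OF p]])
    with that show "Lp_norm p t (t + 1) ((\<lambda>x. u (x + real_of_int k)) - u) \<le> e" by simp
  qed
  then have sub: "range real_of_int \<subseteq> almost_periods p u e" if "0 < e" for e
    using that by blast
  have "relatively_dense (almost_periods p u e)" if "0 < e" for e
    by (rule relatively_dense_mono[OF relatively_dense_Ints sub[OF that]])
  with u show "u \<in> Sp_ap p" by (simp add: Sp_ap_iff)
qed

end

subsection \<open>Periodization\<close>

text \<open>The window \<open>(t, t + 1)\<close> of \<open>u\<close>, transplanted to
  \<open>(c, c + 1)\<close> and continued with period 1. The place \<open>c\<close> matters because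
  it decides at which times \<open>f\<close> meets these values.\<close>

definition periodization :: "(real \<Rightarrow> 'e) \<Rightarrow> real \<Rightarrow> real \<Rightarrow> real \<Rightarrow> 'e" where
  "periodization u t c = (\<lambda>x. u (t + frac (x - c)))"

lemma frac_eq_diff: "real_of_int k < x \<Longrightarrow> x < real_of_int k + 1 \<Longrightarrow> frac x = x - real_of_int k"
  by (simp add: frac_unique_iff)

lemma periodization_eq: "x \<in> {c<..<c + 1} \<Longrightarrow> periodization u t c x = u (x + (t - c))"
  using frac_eq_diff[of 0 "x - c"] by (simp add: periodization_def algebra_simps)

text \<open>Periodicity at every point instead of a.e. turns comparisons between windows into
  pointwise identities; periodizations have it by construction.\<close>

definition Lp_exactly_periodic :: "real \<Rightarrow> (real \<Rightarrow> 'e::real_normed_vector) set" where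
  "Lp_exactly_periodic p = {w \<in> Lp_loc p. \<forall>x. w (x + 1) = w x}"

lemma Lp_exactly_periodic_subset: "Lp_exactly_periodic p \<subseteq> Lp_per p"
  by (auto simp: Lp_exactly_periodic_def Lp_per_def)

lemma Lp_exactly_periodicD: "w \<in> Lp_exactly_periodic p \<Longrightarrow> w \<in> Lp p a b"
  by (simp add: Lp_exactly_periodic_def Lp_loc_def)

context
  fixes p :: real
  assumes p: "1 \<le> p"
begin

lemma periodization_in_Lp_exactly_periodic:
  assumes "u \<in> Lp p t (t + 1)"
  shows "periodization u t c \<in> Lp_exactly_periodic p"
proof -
  have "periodization u t c \<in> Lp_loc p"
  proof (rule Lp_loc_grid[OF p, of _ c])
    fix k :: int
    show "periodization u t c \<in> Lp p (c + real_of_int k) (c + real_of_int k + 1)"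
    proof (rule Lp_AE_cong(1)[OF p])
      show "(\<lambda>x. u (x + (t - c - real_of_int k))) \<in> Lp p (c + real_of_int k) (c + real_of_int k + 1)"
        using Lp_translation(1)[OF p assms, of "t - c - real_of_int k"] by (simp add: algebra_simps)
      have "periodization u t c x = u (x + (t - c - real_of_int k))"
        if "x \<in> {c + real_of_int k<..<c + real_of_int k + 1}" for x
      proof -
        have "frac (x - c) = x - c - real_of_int k" using that by (intro frac_eq_diff) auto
        then have "t + frac (x - c) = x + (t - c - real_of_int k)" by simp
        then show ?thesis by (simp only: periodization_def)
      qed
      then show "AE x in lebesgue. x \<in> {c + real_of_int k<..<c + real_of_int k + 1} \<longrightarrow>
          periodization u t c x = u (x + (t - c - real_of_int k))"
        by (intro AE_I2 impI)
    qed
  qed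
  moreover have "frac (x + 1 - c) = frac (x - c)" for x
    using frac_1_eq[of "x - c"] by (simp add: algebra_simps)
  ultimately show ?thesis by (simp add: Lp_exactly_periodic_def periodization_def)
qed

lemma Lp_norm_exactly_periodic_diff:
  assumes "v \<in> Lp_exactly_periodic p" "w \<in> Lp_exactly_periodic p"
  shows "Lp_norm p t (t + 1) (w - v) = Lp_norm p s (s + 1) (w - v)"
  by (rule Lp_norm_periodic[OF p Lp_loc_diff[OF p]]) (use assms in \<open>auto simp: Lp_exactly_periodic_def\<close>)

lemma Sp_norm_exactly_periodic_diff:
  assumes "v \<in> Lp_exactly_periodic p" "w \<in> Lp_exactly_periodic p"
  shows "Sp_norm p (w - v) = Lp_norm p 0 1 (w - v)"
proof -
  have "w - v \<in> Lp_loc p" using assms p by (auto simp: Lp_exactly_periodic_def intro!: Lp_loc_diff)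
  then show ?thesis
    using Lp_norm_exactly_periodic_diff[OF assms, of _ 0] by (simp add: Sp_norm_eq[OF p])
qed

lemma Lp_norm_window_cong:
  assumes "v \<in> Lp p a b" "\<And>x. x \<in> {a<..<b} \<Longrightarrow> u x = v x"
  shows "Lp_norm p a b u = Lp_norm p a b v"
  by (rule Lp_AE_cong(2)[OF p assms(1)]) (use assms(2) in \<open>intro AE_I2 impI\<close>)

text \<open>Two reductions to finite nets: \<open>t\<close> is replaced by some \<open>s\<close>
  through Bochner's criterion for \<open>u\<close>, and \<open>c\<close> by some \<open>c'\<close>
  modulo 1, since changing \<open>c\<close> rotates a periodic function and translation is
  continuous.\<close>

lemma periodizations_totally_bounded:
  assumes ap: "u \<in> Sp_ap p" and e: "0 < e"
  shows "\<exists>F. finite F \<and> F \<subseteq> Lp_exactly_periodic p \<and>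
    (\<forall>t c. \<exists>v\<in>F. Lp_norm p 0 1 (periodization u t c - v) \<le> e)"
proof -
  have u: "u \<in> Lp_loc p" using ap by (simp add: Sp_ap_iff[OF p])
  have per: "periodization u t c \<in> Lp_exactly_periodic p" for t c
    by (rule periodization_in_Lp_exactly_periodic[OF Lp_locD[OF u]])
  then have perL: "periodization u t c \<in> Lp_loc p" for t c by (simp add: Lp_exactly_periodic_def)
  obtain S where S: "finite S" "\<And>\<tau>. \<exists>s\<in>S. \<tau> - s \<in> almost_periods p u (e/2)"
    using Sp_ap_totally_bounded[OF p ap, of "e/2"] e by auto
  have "\<exists>d. d > 0 \<and> (\<forall>h. \<bar>h\<bar> < d \<longrightarrow>
      Lp_norm p 0 1 ((\<lambda>x. periodization u s 0 (x + h)) - periodization u s 0) \<le> e/2)" for s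
    using Lp_translation_continuous[OF p perL, of "e/2"] e by auto
  then obtain D where D: "\<And>s. D s > 0" "\<And>s h. \<bar>h\<bar> < D s \<Longrightarrow>
      Lp_norm p 0 1 ((\<lambda>x. periodization u s 0 (x + h)) - periodization u s 0) \<le> e/2"
    by metis
  define \<eta> where "\<eta> = Min (insert 1 (D ` S))"
  have \<eta>: "\<eta> > 0" using S(1) D(1) by (auto simp: \<eta>_def)
  obtain S' where S': "finite S'" "\<And>\<tau>. \<exists>c\<in>S'. \<exists>k\<in>range real_of_int. \<bar>\<tau> - c - k\<bar> < \<eta>"
    using relatively_dense_imp_finite_cover[OF relatively_dense_Ints \<eta>] by blast
  define F where "F = (\<lambda>(s, c). periodization u s c) ` (S \<times> S')"
  have "\<exists>v\<in>F. Lp_norm p 0 1 (periodization u t c - v) \<le> e" for t c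
  proof -
    obtain s where s: "s \<in> S" "t - s \<in> almost_periods p u (e/2)" using S(2) by blast
    obtain c' k where c': "c' \<in> S'" "\<bar>c - c' - real_of_int k\<bar> < \<eta>" using S'(2)[of c] by blast
    \<comment> \<open>With this sign \<open>x - c\<close> and \<open>x - c' + h\<close> differ by
      the integer \<open>k\<close>, so their fractional parts agree.\<close>
    define h where "h = - (c - c' - real_of_int k)"
    have "\<eta> \<le> D s" unfolding \<eta>_def using S(1) s(1) by (intro Min_le) auto
    then have h: "\<bar>h\<bar> < D s" using c'(2) by (simp add: h_def)
    have "Lp_norm p 0 1 (periodization u t c - periodization u s c) =
        Lp_norm p c (c + 1) (periodization u t c - periodization u s c)"
      using Lp_norm_exactly_periodic_diff[OF per per, of 0 _ _ _ _ c] by simp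
    also have "\<dots> = Lp_norm p c (c + 1) ((\<lambda>x. u (x + (t - c))) - (\<lambda>x. u (x + (s - c))))"
      by (rule Lp_norm_window_cong)
        (auto simp: periodization_eq intro!: Lp_locD Lp_loc_diff[OF p] Lp_loc_translation[OF p u])
    also have "\<dots> \<le> e/2"
      by (rule Lp_norm_almost_period[OF p u]) (use s(2) in simp)
    finally have 1: "Lp_norm p 0 1 (periodization u t c - periodization u s c) \<le> e/2" .
    let ?k = "periodization u s 0"
    have "frac (x - c) = frac (x - c' + h)" for x
    proof -
      have "x - c = x - c' + h + real_of_int (- k)" by (simp add: h_def)
      then show ?thesis by (simp only: frac_add_of_int_right)
    qed
    then have "periodization u s c - periodization u s c' = (\<lambda>x. ((\<lambda>x. ?k (x + h)) - ?k) (x + - c'))"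
      by (auto simp: periodization_def fun_eq_iff)
    then have "Lp_norm p 0 1 (periodization u s c - periodization u s c') =
        Lp_norm p (- c') (- c' + 1) ((\<lambda>x. ?k (x + h)) - ?k)"
      using Lp_norm_translation[OF p Lp_loc_diff[OF p Lp_loc_translation[OF p perL[of s 0], of h] perL[of s 0]], of 0 1 "- c'"]
      by simp
    also have "\<dots> = Lp_norm p 0 (0 + 1) ((\<lambda>x. ?k (x + h)) - ?k)"
    proof (rule Lp_norm_exactly_periodic_diff[OF per])
      have "?k (x + 1 + h) = ?k (x + h)" for x
        using per[of s 0] unfolding Lp_exactly_periodic_def by (simp only: mem_Collect_eq add.assoc add.commute[of 1 h]) (simp only: add.assoc[symmetric])
      then show "(\<lambda>x. ?k (x + h)) \<in> Lp_exactly_periodic p"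
        using Lp_loc_translation[OF p perL[of s 0], of h] unfolding Lp_exactly_periodic_def by blast
    qed
    also have "\<dots> \<le> e/2" using D(2)[OF h] by simp
    finally have 2: "Lp_norm p 0 1 (periodization u s c - periodization u s c') \<le> e/2" .
    have "Lp_norm p 0 1 (periodization u t c - periodization u s c') \<le> e"
      using Lp_norm_triangle[OF p Lp_locD[OF perL[of t c]] Lp_locD[OF perL[of s c]] Lp_locD[OF perL[of s c']], of 0 1] 1 2
      by linarith
    moreover have "periodization u s c' \<in> F" using s(1) c'(1) by (auto simp: F_def)
    ultimately show ?thesis by blast
  qed
  moreover have "finite F" "F \<subseteq> Lp_exactly_periodic p" using S(1) S'(1) per by (auto simp: F_def)
  ultimately show ?thesis by blast
qed

text \<open>At each \<open>y\<close> the difference is one of the finitely many differences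
  belonging to a fixed \<open>x = w y\<close>, hence dominated by the sum of all their norms.
  Assumption \<open>L\<close> supplies the measurability that domination requires.\<close>

lemma finite_valued_translation:
  fixes f :: "real \<times> 'x \<Rightarrow> 'y::real_normed_vector"
  assumes F: "finite F" "range w \<subseteq> F"
    and f: "\<And>x. x \<in> F \<Longrightarrow> (\<lambda>t. f (t, x)) \<in> Lp_loc p"
    and \<tau>: "\<And>x. x \<in> F \<Longrightarrow> \<tau> \<in> almost_periods p (\<lambda>t. f (t, x)) \<eta>"
    and L: "(\<lambda>y. f (y + \<tau>, w y)) - (\<lambda>y. f (y, w y)) \<in> Lp p t (t + 1)"
  shows "Lp_norm p t (t + 1) ((\<lambda>y. f (y + \<tau>, w y)) - (\<lambda>y. f (y, w y))) \<le> real (card F) * \<eta>"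
proof -
  define g where "g = (\<lambda>x y. norm (((\<lambda>t. f (t + \<tau>, x)) - (\<lambda>t. f (t, x))) y))"
  have g: "g x \<in> Lp p t (t + 1)" "Lp_norm p t (t + 1) (g x) \<le> \<eta>" if "x \<in> F" for x
  proof -
    have *: "(\<lambda>t. f (t + \<tau>, x)) - (\<lambda>t. f (t, x)) \<in> Lp p t (t + 1)"
      using Lp_locD[OF Lp_loc_diff[OF p Lp_loc_translation[OF p f[OF that], of \<tau>] f[OF that]]] .
    show "g x \<in> Lp p t (t + 1)" "Lp_norm p t (t + 1) (g x) \<le> \<eta>"
      using Lp_norm_real[OF p *] \<tau>[OF that] by (auto simp: g_def almost_periods_def)
  qed
  have sum: "(\<lambda>y. \<Sum>x\<in>F. g x y) \<in> Lp p t (t + 1) \<and>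
      Lp_norm p t (t + 1) (\<lambda>y. \<Sum>x\<in>F. g x y) \<le> (\<Sum>x\<in>F. Lp_norm p t (t + 1) (g x))"
    using F(1) g(1) by (rule Lp_sum[OF p])
  have "Lp_norm p t (t + 1) ((\<lambda>y. f (y + \<tau>, w y)) - (\<lambda>y. f (y, w y))) \<le> Lp_norm p t (t + 1) (\<lambda>y. \<Sum>x\<in>F. g x y)"
  proof (rule Lp_dominated(2)[OF p conjunct1[OF sum] LpD[OF L]], intro AE_I2 impI)
    fix y
    have "g (w y) y \<le> (\<Sum>x\<in>F. g x y)"
      using F by (intro member_le_sum) (auto simp: g_def)
    then show "norm (((\<lambda>y. f (y + \<tau>, w y)) - (\<lambda>y. f (y, w y))) y) \<le> norm (\<Sum>x\<in>F. g x y)"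
      by (simp add: g_def)
  qed
  also have "\<dots> \<le> (\<Sum>x\<in>F. \<eta>)"
    using sum g(2) by (intro order_trans[OF conjunct2[OF sum] sum_mono])
  finally show ?thesis by simp
qed

end

subsection \<open>Superposition operators\<close>

context
  fixes p q :: real and f :: "real \<times> 'x::banach \<Rightarrow> 'y::banach"
  assumes p: "1 \<le> p" and q: "1 \<le> q"
    and nemytskii_BSp: "\<And>u. u \<in> Lp_per p \<Longrightarrow> nemytskii f u \<in> BSp q"
    and nemytskii_continuous: "norm_continuous_on (Sp_norm p) (Sp_norm q) (Lp_per p) (nemytskii f)"
begin

text \<open>The gain over continuity of \<open>H\<close> is that one \<open>\<delta>\<close> serves
  all \<open>t\<close> and \<open>c\<close>. On exactly periodic functions the Stepanov distance is
  the distance on (0,1), so the compactness lemma applies with the latter.\<close>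

lemma nemytskii_uniform_on_periodizations:
  assumes ap: "u \<in> Sp_ap p" and e: "0 < e"
  shows "\<exists>\<delta>>0. \<forall>t c. \<forall>w\<in>Lp_exactly_periodic p. Lp_norm p 0 1 (w - periodization u t c) < \<delta> \<longrightarrow>
    Sp_norm q (nemytskii f w - nemytskii f (periodization u t c)) < e"
proof -
  have u: "u \<in> Lp_loc p" using ap by (simp add: Sp_ap_iff[OF p])
  have per: "periodization u t c \<in> Lp_exactly_periodic p" for t c
    by (rule periodization_in_Lp_exactly_periodic[OF p Lp_locD[OF u]])
  note PL = Lp_exactly_periodicD
  have B: "nemytskii f w \<in> BSp q" if "w \<in> Lp_exactly_periodic p" for w
    using that Lp_exactly_periodic_subset nemytskii_BSp by blast
  have "\<exists>\<delta>>0. \<forall>v\<in>range (\<lambda>(t, c). periodization u t c). \<forall>w\<in>Lp_exactly_periodic p. Lp_norm p 0 1 (w - v) < \<delta> \<longrightarrow>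
      Sp_norm q (nemytskii f w - nemytskii f v) < e"
  proof (rule uniform_continuity_near_totally_bounded[where d = "\<lambda>v w. Lp_norm p 0 1 (w - v)"
        and \<rho> = "\<lambda>v w. Sp_norm q (nemytskii f w - nemytskii f v)" and L = "Lp_exactly_periodic p"])
    fix x y z :: "real \<Rightarrow> 'x"
    assume L: "x \<in> Lp_exactly_periodic p" "y \<in> Lp_exactly_periodic p" "z \<in> Lp_exactly_periodic p"
    show "Lp_norm p 0 1 (z - x) \<le> Lp_norm p 0 1 (y - x) + Lp_norm p 0 1 (z - y)"
      using Lp_norm_triangle[OF p PL[OF L(3)] PL[OF L(2)] PL[OF L(1)], of 0 1] by simp
    show "Sp_norm q (nemytskii f z - nemytskii f y)
        \<le> Sp_norm q (nemytskii f y - nemytskii f x) + Sp_norm q (nemytskii f z - nemytskii f x)"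
      using Sp_norm_triangle[OF q B[OF L(3)] B[OF L(1)] B[OF L(2)]]
        Sp_norm_minus_commute[OF q, of "nemytskii f x" "nemytskii f y"] by simp
  next
    fix x y :: "real \<Rightarrow> 'x"
    show "Lp_norm p 0 1 (y - x) = Lp_norm p 0 1 (x - y)" by (rule Lp_norm_minus_commute)
  next
    fix x :: "real \<Rightarrow> 'x" and e :: real
    assume x: "x \<in> Lp_exactly_periodic p" and e: "0 < e"
    have "x \<in> Lp_per p" using x Lp_exactly_periodic_subset by (rule rev_subsetD)
    from nemytskii_continuous[unfolded norm_continuous_on_def, rule_format, OF this e]
    obtain \<delta> where \<delta>: "\<delta> > 0" "\<And>y. y \<in> Lp_per p \<Longrightarrow> Sp_norm p (y - x) < \<delta> \<Longrightarrow>
        Sp_norm q (nemytskii f y - nemytskii f x) < e" by auto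
    have "Sp_norm q (nemytskii f y - nemytskii f x) < e"
      if y: "y \<in> Lp_exactly_periodic p" and "Lp_norm p 0 1 (y - x) < \<delta>" for y
      using that(2) rev_subsetD[OF y Lp_exactly_periodic_subset]
      by (intro \<delta>(2)) (simp_all add: Sp_norm_exactly_periodic_diff[OF p x y])
    then show "\<exists>\<delta>>0. \<forall>y\<in>Lp_exactly_periodic p. Lp_norm p 0 1 (y - x) < \<delta> \<longrightarrow>
        Sp_norm q (nemytskii f y - nemytskii f x) < e"
      using \<delta>(1) by (intro exI[of _ \<delta>] conjI ballI impI)
  next
    show "range (\<lambda>(t, c). periodization u t c) \<subseteq> Lp_exactly_periodic p" using per by auto
  next
    fix e :: real assume "0 < e"
    from periodizations_totally_bounded[OF p ap this] obtain F where
      F: "finite F" "F \<subseteq> Lp_exactly_periodic p" "\<And>t c. \<exists>v\<in>F. Lp_norm p 0 1 (periodization u t c - v) \<le> e"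
      by auto
    show "\<exists>F. finite F \<and> F \<subseteq> Lp_exactly_periodic p \<and>
        (\<forall>k\<in>range (\<lambda>(t, c). periodization u t c). \<exists>x\<in>F. Lp_norm p 0 1 (k - x) \<le> e)"
    proof (intro exI[of _ F] conjI ballI)
      fix k assume "k \<in> range (\<lambda>(t, c). periodization u t c)"
      then obtain t c where "k = periodization u t c" by auto
      then show "\<exists>x\<in>F. Lp_norm p 0 1 (k - x) \<le> e" using F(3) by simp
    qed (use F in simp_all)
  next
    fix v :: "nat \<Rightarrow> real \<Rightarrow> 'x"
    assume v: "\<And>n. v n \<in> range (\<lambda>(t, c). periodization u t c)"
      "\<And>n. Lp_norm p 0 1 (v n - v (Suc n)) \<le> (1/2) ^ n"
    have vL: "v n \<in> Lp_exactly_periodic p" for n using v(1)[of n] per by auto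
    have "Lp_norm p 0 1 (v (Suc n) - v n) \<le> (1/2) ^ n" for n
      using v(2)[of n] Lp_norm_minus_commute[of p 0 1 "v n"] by simp
    from Lp_complete[OF p PL[OF vL] this] obtain w where
      w: "w \<in> Lp p 0 1" "\<And>n. Lp_norm p 0 1 (v n - w) \<le> 7 * (1/2) ^ n" by blast
    \<comment> \<open>The limit \<open>w\<close> is controlled on (0,1) only; periodizing it leaves
      it unchanged there and puts it into the space.\<close>
    have "Lp_norm p 0 1 (v n - periodization w 0 0) = Lp_norm p 0 1 (v n - w)" for n
      by (rule Lp_norm_window_cong[OF p Lp_diff(1)[OF p PL[OF vL] w(1)]]) (simp add: periodization_eq)
    moreover have "periodization w 0 0 \<in> Lp_exactly_periodic p"
      using w(1) by (intro periodization_in_Lp_exactly_periodic[OF p]) simp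
    ultimately show "\<exists>x\<in>Lp_exactly_periodic p. \<forall>n. Lp_norm p 0 1 (v n - x) \<le> 7 * (1/2) ^ n"
      using w(2) by metis
  qed (use e in auto)
  then show ?thesis by auto
qed

text \<open>On each unit cell \<open>z\<close> agrees with a periodic function, whose image lies in
  \<open>BSp q\<close>. Since \<open>f\<close> is arbitrary, even the measurability of the image
  comes from there.\<close>

lemma nemytskii_Lp_loc:
  assumes z: "z \<in> Lp_loc p"
  shows "nemytskii f z \<in> Lp_loc q"
proof (rule Lp_loc_grid[OF q, of _ 0])
  fix k :: int
  let ?c = "0 + real_of_int k"
  have "nemytskii f (periodization z ?c ?c) \<in> BSp q"
    using periodization_in_Lp_exactly_periodic[OF p Lp_locD[OF z]] Lp_exactly_periodic_subset nemytskii_BSp by blast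
  then have "nemytskii f (periodization z ?c ?c) \<in> Lp_loc q" by (simp add: BSp_iff[OF q])
  then show "nemytskii f z \<in> Lp q ?c (?c + 1)"
    by (rule Lp_AE_cong(1)[OF q Lp_locD]) (intro AE_I2 impI, simp add: nemytskii_def periodization_eq)
qed

text \<open>Both functions are periodized from the window \<open>(a, a + 1)\<close>, where they
  agree with their periodizations. Independence of \<open>\<delta>\<close> from the shift
  \<open>b\<close> permits comparison with translates of \<open>u\<close> while \<open>f\<close>
  stays in place.\<close>

lemma nemytskii_uniform_on_windows:
  assumes ap: "u \<in> Sp_ap p" and e: "0 < e"
  shows "\<exists>\<delta>>0. \<forall>z\<in>Lp_loc p. \<forall>a b. Lp_norm p a (a + 1) (z - (\<lambda>x. u (x + b))) < \<delta> \<longrightarrow>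
    Lp_norm q a (a + 1) (nemytskii f z - nemytskii f (\<lambda>x. u (x + b))) \<le> e"
proof -
  have u: "u \<in> Lp_loc p" using ap by (simp add: Sp_ap_iff[OF p])
  obtain \<delta> where \<delta>: "\<delta> > 0" "\<And>t c w. w \<in> Lp_exactly_periodic p \<Longrightarrow> Lp_norm p 0 1 (w - periodization u t c) < \<delta> \<Longrightarrow>
    Sp_norm q (nemytskii f w - nemytskii f (periodization u t c)) < e"
    using nemytskii_uniform_on_periodizations[OF assms] by blast
  have "Lp_norm q a (a + 1) (nemytskii f z - nemytskii f (\<lambda>x. u (x + b))) \<le> e"
    if z: "z \<in> Lp_loc p" and d: "Lp_norm p a (a + 1) (z - (\<lambda>x. u (x + b))) < \<delta>" for z a b
  proof -
    \<comment> \<open>On \<open>(a, a + 1)\<close> this equals \<open>u (x + b)\<close>: the content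
      comes from the window at \<open>a + b\<close>, and \<open>f\<close> acts at
      \<open>a\<close>.\<close>
    define v where "v = periodization u (a + b) a"
    define w where "w = periodization z a a"
    have v: "v \<in> Lp_exactly_periodic p" and w: "w \<in> Lp_exactly_periodic p"
      using periodization_in_Lp_exactly_periodic[OF p Lp_locD[OF u]]
        periodization_in_Lp_exactly_periodic[OF p Lp_locD[OF z]] by (auto simp: v_def w_def)
    have ub: "(\<lambda>x. u (x + b)) \<in> Lp_loc p" by (rule Lp_loc_translation[OF p u])
    have eq: "w x = z x" "v x = u (x + b)" if "x \<in> {a<..<a + 1}" for x
      using that by (simp_all add: v_def w_def periodization_eq)
    have "Lp_norm p 0 1 (w - v) = Lp_norm p a (a + 1) (w - v)"
      using Lp_norm_exactly_periodic_diff[OF p v w, of 0 a] by simp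
    also have "\<dots> = Lp_norm p a (a + 1) (z - (\<lambda>x. u (x + b)))"
      by (rule Lp_norm_window_cong[OF p Lp_locD[OF Lp_loc_diff[OF p z ub]]]) (simp add: eq)
    finally have *: "Sp_norm q (nemytskii f w - nemytskii f v) < e"
      using d \<delta>(2)[OF w] by (simp add: v_def)
    have "Lp_norm q a (a + 1) (nemytskii f z - nemytskii f (\<lambda>x. u (x + b))) =
        Lp_norm q a (a + 1) (nemytskii f w - nemytskii f v)"
    proof (rule Lp_norm_window_cong[OF q])
      show "nemytskii f w - nemytskii f v \<in> Lp q a (a + 1)"
        using v w by (intro Lp_diff(1)[OF q] Lp_locD nemytskii_Lp_loc) (auto simp: Lp_exactly_periodic_def)
    qed (simp add: nemytskii_def eq)
    also have "\<dots> \<le> Sp_norm q (nemytskii f w - nemytskii f v)"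
      using v w Lp_exactly_periodic_subset
      by (intro Lp_norm_le_Sp_norm[OF q] BSp_diff[OF q] nemytskii_BSp) auto
    finally show ?thesis using * by simp
  qed
  with \<delta>(1) show ?thesis by blast
qed

lemma nemytskii_continuous_on_Sp_ap:
  "norm_continuous_on (Sp_norm p) (Sp_norm q) (Sp_ap p) (nemytskii f)"
  unfolding norm_continuous_on_def
proof (intro ballI allI impI)
  fix u :: "real \<Rightarrow> 'x" and e :: real assume u: "u \<in> Sp_ap p" and e: "0 < e"
  have loc: "v \<in> Lp_loc p" if "v \<in> Sp_ap p" for v :: "real \<Rightarrow> 'x" using that by (simp add: Sp_ap_iff[OF p])
  obtain \<delta> where \<delta>: "\<delta> > 0" "\<And>z a b. z \<in> Lp_loc p \<Longrightarrow> Lp_norm p a (a + 1) (z - (\<lambda>x. u (x + b))) < \<delta> \<Longrightarrow>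
      Lp_norm q a (a + 1) (nemytskii f z - nemytskii f (\<lambda>x. u (x + b))) \<le> e/2"
    using nemytskii_uniform_on_windows[OF u, of "e/2"] e by auto
  have "Sp_norm q (nemytskii f y - nemytskii f u) < e"
    if y: "y \<in> Sp_ap p" and d: "Sp_norm p (y - u) < \<delta>" for y
  proof -
    \<comment> \<open>Bounds on all windows pass to the supremum only as a non-strict inequality,
      hence \<open>e/2\<close>.\<close>
    have "Sp_norm q (nemytskii f y - nemytskii f u) \<le> e/2"
    proof (rule Sp_norm_le[OF q])
      show "nemytskii f y - nemytskii f u \<in> Lp_loc q"
        using y u loc by (intro Lp_loc_diff[OF q] nemytskii_Lp_loc)
      show "Lp_norm q t (t + 1) (nemytskii f y - nemytskii f u) \<le> e/2" for t
      proof -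
        have "y - u \<in> BSp p" using y u Sp_ap_subset_BSp[OF p] by (intro BSp_diff[OF p]) auto
        then have "Lp_norm p t (t + 1) (y - u) < \<delta>"
          using le_less_trans[OF Lp_norm_le_Sp_norm[OF p] d] by blast
        then show ?thesis using \<delta>(2)[OF loc[OF y], of t 0] by simp
      qed
    qed
    then show ?thesis using e by simp
  qed
  with \<delta>(1) show "\<exists>\<delta>>0. \<forall>y\<in>Sp_ap p. Sp_norm p (y - u) < \<delta> \<longrightarrow>
      Sp_norm q (nemytskii f y - nemytskii f u) < e" by blast
qed

text \<open>The comparison runs from \<open>f (x + \<tau>, u (x + \<tau>))\<close> via
  \<open>f (x + \<tau>, u x)\<close>, \<open>f (x + \<tau>, w x)\<close> and
  \<open>f (x, w x)\<close> to \<open>f (x, u x)\<close>, at a cost of \<open>e/4\<close> each. All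
  steps but the third use uniformity on windows; the third uses almost periods of \<open>f\<close>
  at fixed values.\<close>

lemma nemytskii_Sp_ap:
  assumes f: "\<And>x. (\<lambda>t. f (t, x)) \<in> Sp_ap q" and ap: "u \<in> Sp_ap p"
  shows "nemytskii f u \<in> Sp_ap q"
proof -
  have u: "u \<in> Lp_loc p" using ap by (simp add: Sp_ap_iff[OF p])
  have fL: "(\<lambda>t. f (t, x)) \<in> Lp_loc q" for x using f by (simp add: Sp_ap_iff[OF q])
  note trp = Lp_loc_translation[OF p] and trq = Lp_loc_translation[OF q]
  have "relatively_dense (almost_periods q (nemytskii f u) e)" if e: "0 < e" for e
  proof -
    obtain \<delta> where \<delta>: "\<delta> > 0" "\<And>z a b. z \<in> Lp_loc p \<Longrightarrow> Lp_norm p a (a + 1) (z - (\<lambda>x. u (x + b))) < \<delta> \<Longrightarrow>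
        Lp_norm q a (a + 1) (nemytskii f z - nemytskii f (\<lambda>x. u (x + b))) \<le> e/4"
      using nemytskii_uniform_on_windows[OF ap, of "e/4"] e by auto
    obtain S where S: "finite S" "\<And>\<tau>. \<exists>s\<in>S. \<tau> - s \<in> almost_periods p u (\<delta>/2)"
      using Sp_ap_totally_bounded[OF p ap, of "\<delta>/2"] \<delta>(1) by auto
    have "\<exists>w. simple_function lebesgue w \<and> Lp_norm p s (s + 1) (u - w) < \<delta>/2" for s
      using Lp_simple_function_dense[OF p Lp_locD[OF u] half_gt_zero[OF \<delta>(1)]] .
    then obtain W where W: "\<And>s. simple_function lebesgue (W s)" "\<And>s. Lp_norm p s (s + 1) (u - W s) < \<delta>/2"
      by metis
    have WL: "W s \<in> Lp_loc p" for s using Lp_simple[OF p W(1)] by (simp add: Lp_loc_def)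
    \<comment> \<open>Simple approximations are chosen only at the finitely many net windows; every
      other window uses a translate of one of them, so \<open>F\<close> is finite and the same for
      all windows.\<close>
    define F where "F = (\<Union>s\<in>S. range (W s))"
    have F: "finite F" using S(1) W(1) by (auto simp: F_def simple_function_def)
    define \<eta> where "\<eta> = e / (4 * (real (card F) + 1))"
    have \<eta>: "0 < \<eta>" using e by (simp add: \<eta>_def)
    have F\<eta>: "real (card F) * \<eta> \<le> e/4"
    proof -
      have "real (card F) * \<eta> \<le> (real (card F) + 1) * \<eta>" using \<eta> by (intro mult_right_mono) auto
      also have "\<dots> = e/4"
        by (simp add: \<eta>_def add_pos_nonneg field_simps)
      finally show ?thesis .
    qed
    \<comment> \<open>\<open>None\<close> stands for \<open>u\<close> and \<open>Some x\<close> for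
      \<open>f\<close> at the fixed value \<open>x\<close>. Tolerances are half of those wanted,
      since the pigeonhole lemma returns differences.\<close>
    define A where "A = (\<lambda>i. case i of None \<Rightarrow> almost_periods p u (\<delta>/4)
        | Some x \<Rightarrow> almost_periods q (\<lambda>t. f (t, x)) (\<eta>/2))"
    define T where "T = {\<tau>. \<forall>i\<in>insert None (Some ` F). \<exists>x\<in>A i. \<exists>y\<in>A i. \<tau> = x - y}"
    have "relatively_dense T"
      unfolding T_def
    proof (rule relatively_dense_common_differences)
      show "\<exists>S. finite S \<and> (\<forall>\<tau>. \<exists>s\<in>S. \<tau> - s \<in> A i)" for i
        using Sp_ap_totally_bounded[OF p ap, of "\<delta>/4"] Sp_ap_totally_bounded[OF q f, of "\<eta>/2"] \<delta>(1) \<eta>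
        by (cases i) (auto simp: A_def)
    qed (use F in auto)
    moreover have "T \<subseteq> almost_periods q (nemytskii f u) e"
    proof
      fix \<tau> assume \<tau>: "\<tau> \<in> T"
      then obtain x y where "x \<in> almost_periods p u (\<delta>/4)" "y \<in> almost_periods p u (\<delta>/4)" "\<tau> = x - y"
        by (auto simp: T_def A_def)
      then have \<tau>u: "\<tau> \<in> almost_periods p u (\<delta>/2)"
        using almost_periods_diff[OF p u, of x "\<delta>/4" y "\<delta>/4"] by simp
      have \<tau>f: "\<tau> \<in> almost_periods q (\<lambda>t. f (t, x)) \<eta>" if "x \<in> F" for x
      proof -
        have "\<exists>a\<in>A (Some x). \<exists>b\<in>A (Some x). \<tau> = a - b" using \<tau> that by (simp add: T_def)
        then obtain a b where "a \<in> almost_periods q (\<lambda>t. f (t, x)) (\<eta>/2)" "b \<in> almost_periods q (\<lambda>t. f (t, x)) (\<eta>/2)" "\<tau> = a - b"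
          by (auto simp: A_def)
        then show ?thesis using almost_periods_diff[OF q fL, of a x "\<eta>/2" b "\<eta>/2"] by simp
      qed
      show "\<tau> \<in> almost_periods q (nemytskii f u) e"
        unfolding almost_periods_def
      proof (intro CollectI allI)
        fix t
        obtain s where s: "s \<in> S" "t - s \<in> almost_periods p u (\<delta>/2)" using S(2) by blast
        \<comment> \<open>The approximation of \<open>u\<close> at the window \<open>s\<close>,
          moved back to \<open>t\<close>: one \<open>\<delta>/2\<close> pays for the approximation,
          the other for replacing \<open>u\<close> by its translate by \<open>s - t\<close>.\<close>
        define w where "w = (\<lambda>x. W s (x + (s - t)))"
        have wL: "w \<in> Lp_loc p" unfolding w_def by (rule trp[OF WL])
        have wF: "range w \<subseteq> F" using s(1) by (auto simp: w_def F_def)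
        have wu: "Lp_norm p t (t + 1) (w - u) < \<delta>"
        proof -
          have "Lp_norm p t (t + 1) (w - u) \<le> Lp_norm p t (t + 1) (w - (\<lambda>x. u (x + (s - t)))) + Lp_norm p t (t + 1) ((\<lambda>x. u (x + (s - t))) - u)"
            by (rule Lp_norm_triangle[OF p Lp_locD[OF wL] Lp_locD[OF trp[OF u]] Lp_locD[OF u]])
          also have "Lp_norm p t (t + 1) (w - (\<lambda>x. u (x + (s - t)))) = Lp_norm p s (s + 1) (W s - u)"
            using Lp_norm_translation[OF p Lp_loc_diff[OF p WL[of s] u], of t "t + 1" "s - t"]
            by (simp add: w_def fun_diff_def add.commute)
          also have "\<dots> < \<delta>/2" using W(2)[of s] Lp_norm_minus_commute[of p s "s + 1" u] by simp
          also have "Lp_norm p t (t + 1) ((\<lambda>x. u (x + (s - t))) - u) = Lp_norm p t (t + 1) ((\<lambda>x. u (x + 0)) - (\<lambda>x. u (x + (s - t))))"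
            using Lp_norm_minus_commute[of p t "t + 1" u] by simp
          also have "\<dots> \<le> \<delta>/2" by (rule Lp_norm_almost_period[OF p u]) (use s(2) in simp)
          finally show ?thesis by (simp only: field_sum_of_halves)
        qed
        \<comment> \<open>Steps at time \<open>x + \<tau>\<close> are estimated on the window at
          \<open>t + \<tau>\<close>, where the values of \<open>u\<close> and \<open>w\<close> near
          \<open>t\<close> appear as translates by \<open>- \<tau>\<close>.\<close>
        define g0 where "g0 = (\<lambda>x. nemytskii f u (x + \<tau>))"
        define g1 where "g1 = (\<lambda>x. nemytskii f (\<lambda>y. u (y + - \<tau>)) (x + \<tau>))"
        define g2 where "g2 = (\<lambda>x. nemytskii f (\<lambda>y. w (y + - \<tau>)) (x + \<tau>))"
        have gL: "g0 \<in> Lp_loc q" "g1 \<in> Lp_loc q" "g2 \<in> Lp_loc q"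
          unfolding g0_def g1_def g2_def by (intro trq nemytskii_Lp_loc trp u wL)+
        have NL: "nemytskii f w \<in> Lp_loc q" "nemytskii f u \<in> Lp_loc q"
          by (intro nemytskii_Lp_loc wL u)+
        have 1: "Lp_norm q t (t + 1) (g0 - g1) \<le> e/4"
        proof -
          have "Lp_norm p (t + \<tau>) (t + \<tau> + 1) (u - (\<lambda>y. u (y + - \<tau>))) = Lp_norm p t (t + 1) ((\<lambda>x. u (x + \<tau>)) - u)"
            using Lp_norm_translation[OF p Lp_loc_diff[OF p u trp[OF u, of "- \<tau>"]], of t "t + 1" \<tau>]
            by (simp add: fun_diff_def add_ac)
          also have "\<dots> \<le> \<delta>/2" using \<tau>u unfolding almost_periods_def by blast
          also have "\<dots> < \<delta>" using \<delta>(1) by simp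
          finally have "Lp_norm q (t + \<tau>) (t + \<tau> + 1) (nemytskii f u - nemytskii f (\<lambda>y. u (y + - \<tau>))) \<le> e/4"
            by (rule \<delta>(2)[OF u])
          then show ?thesis
            using Lp_norm_translation[OF q Lp_loc_diff[OF q NL(2) nemytskii_Lp_loc[OF trp[OF u, of "- \<tau>"]]], of t "t + 1" \<tau>]
            by (simp add: g0_def g1_def fun_diff_def add_ac)
        qed
        have 2: "Lp_norm q t (t + 1) (g1 - g2) \<le> e/4"
        proof -
          have "Lp_norm p (t + \<tau>) (t + \<tau> + 1) ((\<lambda>y. w (y + - \<tau>)) - (\<lambda>y. u (y + - \<tau>))) = Lp_norm p t (t + 1) (w - u)"
            using Lp_norm_translation[OF p Lp_loc_diff[OF p trp[OF wL, of "- \<tau>"] trp[OF u, of "- \<tau>"]], of t "t + 1" \<tau>]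
            by (simp add: fun_diff_def add_ac)
          also note wu
          finally have "Lp_norm q (t + \<tau>) (t + \<tau> + 1) (nemytskii f (\<lambda>y. w (y + - \<tau>)) - nemytskii f (\<lambda>y. u (y + - \<tau>))) \<le> e/4"
            by (rule \<delta>(2)[OF trp[OF wL]])
          then have "Lp_norm q t (t + 1) (g2 - g1) \<le> e/4"
            using Lp_norm_translation[OF q Lp_loc_diff[OF q nemytskii_Lp_loc[OF trp[OF wL, of "- \<tau>"]] nemytskii_Lp_loc[OF trp[OF u, of "- \<tau>"]]], of t "t + 1" \<tau>]
            by (simp add: g1_def g2_def fun_diff_def add_ac)
          then show ?thesis using Lp_norm_minus_commute[of q t "t + 1" g1 g2] by simp
        qed
        have 3: "Lp_norm q t (t + 1) (g2 - nemytskii f w) \<le> e/4"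
        proof -
          have eq: "g2 - nemytskii f w = (\<lambda>y. f (y + \<tau>, w y)) - (\<lambda>y. f (y, w y))"
            by (auto simp: g2_def nemytskii_def)
          show ?thesis
            unfolding eq
            using Lp_locD[OF Lp_loc_diff[OF q gL(3) NL(1)], of t "t + 1", unfolded eq]
            by (intro order_trans[OF finite_valued_translation[OF q F wF fL \<tau>f] F\<eta>])
        qed
        have 4: "Lp_norm q t (t + 1) (nemytskii f w - nemytskii f u) \<le> e/4"
          using \<delta>(2)[OF wL, of t 0] wu by simp
        have "Lp_norm q t (t + 1) (g0 - nemytskii f u) \<le> Lp_norm q t (t + 1) (g0 - g1) + (Lp_norm q t (t + 1) (g1 - g2)
            + (Lp_norm q t (t + 1) (g2 - nemytskii f w) + Lp_norm q t (t + 1) (nemytskii f w - nemytskii f u)))"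
          by (rule order_trans[OF Lp_norm_triangle[OF q Lp_locD[OF gL(1)] Lp_locD[OF gL(2)] Lp_locD[OF NL(2)]]
                add_left_mono, OF order_trans[OF Lp_norm_triangle[OF q Lp_locD[OF gL(2)] Lp_locD[OF gL(3)] Lp_locD[OF NL(2)]]
                add_left_mono, OF Lp_norm_triangle[OF q Lp_locD[OF gL(3)] Lp_locD[OF NL(1)] Lp_locD[OF NL(2)]]]])
        also have "\<dots> \<le> e" using 1 2 3 4 by simp
        finally show "Lp_norm q t (t + 1) ((\<lambda>x. nemytskii f u (x + \<tau>)) - nemytskii f u) \<le> e"
          by (simp add: g0_def)
      qed
    qed
    ultimately show ?thesis by (rule relatively_dense_mono)
  qed
  then show ?thesis using nemytskii_Lp_loc[OF u] by (simp add: Sp_ap_iff[OF q])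
qed

end

theorem theorem4p2:
  fixes f :: "real \<times> 'x::banach \<Rightarrow> 'y::banach"
    and p q :: real
  assumes "1 \<le> p" and "1 \<le> q"
  defines "assertion_i \<equiv>
      (\<forall>u\<in>Sp_ap p. nemytskii f u \<in> Sp_ap q) \<and>
      norm_continuous_on (Sp_norm p) (Sp_norm q) (Sp_ap p) (nemytskii f)"
    and "assertion_ii \<equiv>
      (\<forall>u\<in>Lp_per p. nemytskii f u \<in> Sp_ap q) \<and>
      norm_continuous_on (Sp_norm p) (Sp_norm q) (Lp_per p) (nemytskii f)"
    and "assertion_iii \<equiv>
      (\<forall>x. (\<lambda>t. f (t, x)) \<in> Sp_ap q) \<and>
      (\<forall>u\<in>Lp_per p. nemytskii f u \<in> BSp q) \<and>
      norm_continuous_on (Sp_norm p) (Sp_norm q) (Lp_per p) (nemytskii f)"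
  shows "(assertion_i \<longleftrightarrow> assertion_ii) \<and> (assertion_ii \<longleftrightarrow> assertion_iii)"
proof -
  have "assertion_ii" if assertion_i
    using that Lp_per_subset_Sp_ap[OF assms(1)]
    unfolding assertion_i_def assertion_ii_def norm_continuous_on_def by (meson subsetD)
  moreover have "assertion_iii" if ii: assertion_ii
  proof -
    \<comment> \<open>Constants are periodic, and their images under \<open>nemytskii f\<close> are
      the functions \<open>f\<close> at a fixed value.\<close>
    have "(\<lambda>_. x) \<in> Lp_per p" for x :: 'x
      using Lp_loc_const[OF assms(1)] by (simp add: Lp_per_def)
    then have "nemytskii f (\<lambda>_. x) \<in> Sp_ap q" for x
      using ii by (simp add: assertion_ii_def)
    then show ?thesis
      using ii Sp_ap_subset_BSp[OF assms(2)] unfolding assertion_ii_def assertion_iii_def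
      by (auto simp: nemytskii_def)
  qed
  moreover have "assertion_i" if "assertion_iii"
  proof -
    have iii: "\<And>x. (\<lambda>t. f (t, x)) \<in> Sp_ap q" "\<And>u. u \<in> Lp_per p \<Longrightarrow> nemytskii f u \<in> BSp q"
        "norm_continuous_on (Sp_norm p) (Sp_norm q) (Lp_per p) (nemytskii f)"
      using that by (auto simp: assertion_iii_def)
    show ?thesis
      unfolding assertion_i_def
      using nemytskii_Sp_ap[OF assms(1,2) iii(2,3,1)] nemytskii_continuous_on_Sp_ap[OF assms(1,2) iii(2,3)] by blast
  qed
  ultimately show ?thesis by blast
qed

end
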